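(* Let $(Y,Z)=\{(Y_t,Z_t)\mid t\in\mathbb{R}\}$ be a two-sided process with right-continuous nondecreasing real-valued components, $Y_0=Z_0=0$, such that $Y$ and $Z$ jointly have stationary increments and all jumps of $Z$ are at most $1$. For an a.s. finite random variable $X_0$, let $X=\{X_t\mid t\ge0\}$ be the unique process satisfying $$X_t=X_0+Y_t-\int_{(0,t]}X_{s-}\,\mathrm{d}Z_s,\qquad t\ge 0.$$ Let $J$, $N$ and $T_1$ be the two-sided processes and the random time, associated with $Z$, defined in the context. If $\int_{(-\infty,0]}e^{J_s}\,\mathrm{d}Y_s<\infty$ a.s., and either $T_1<\infty$ a.s. or $J_t\to\infty$ a.s. as $t\to\infty$, then $X$ has the unique stationary version $$X^*_t=\int_{(-\infty,t]}e^{-(J_t-J_s)}1_{\{N_t-N_s=0\}}\,\mathrm{d}Y_s,$$ and for every a.s. finite initial $X_0$, $X_t$ converges in distribution to $X^*_0$ as $t\to\infty$. Moreover, when $X_0=0$ a.s., $X_t$ is stochastically increasing in $t\ge 0$.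
   Context: Jointly stationary increments (in the strong sense): for $s\in\mathbb{R}$, let $\theta_s(Y,Z)$ be the process $t\mapsto (Y_{t+s}-Y_s,\;Z_{t+s}-Z_s)$, $t\in\mathbb{R}$; the law of the process $\theta_s(Y,Z)$ does not depend on $s$. Notation: $\Delta Z_t=Z_t-Z_{t-}$; $Z^c$ is the continuous part of $Z$ (i.e. $Z$ with its jumps removed), normalized by $Z^c_0=0$, so $Z^c_t-Z^c_s=Z_t-Z_s-\sum_{s<u\le t}\Delta Z_u$ for $s\le t$. The two-sided nondecreasing processes $J$ and $N$ are defined by $J_0=N_0=0$ and, for all real $s\le t$, $$J_t-J_s=Z^c_t-Z^c_s-\sum_{s<u\le t}\log(1-\Delta Z_u)\,1_{\{\Delta Z_u<1\}},\qquad N_t-N_s=\sum_{s<u\le t}1_{\{\Delta Z_u=1\}}.$$ In particular, for $t\ge 0$, $J_t=Z^c_t-\sum_{0<u\le t}\log(1-\Delta Z_u)1_{\{\Delta Z_u<1\}}$ and $N_t=\sum_{0<u\le t}1_{\{\Delta Z_u=1\}}$, and $J_s\le 0$ for $s\le 0$. Furthermore $T_1=\inf\{t>0\mid \Delta Z_t=1\}$ (with $\inf\emptyset=\infty$), so that $T_1<\infty$ is equivalent to $\lim_{t\to\infty}N_t\ge 1$. All integrals are pathwise Lebesgue–Stieltjes integrals. A stationary version of $X$ is a stationary process $X^*$ satisfying the same equation $X^*_t=X^*_0+Y_t-\int_{(0,t]}X^*_{s-}\,\mathrm{d}Z_s$ for $t\ge 0$ (i.e. the solution with initial value $X^*_0$);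 uniqueness is in law. "Stochastically increasing in $t$" means that $P(X_t>a)$ is nondecreasing in $t\ge0$ for every real $a$. *)

theory Defs
  imports "HOL-Probability.Probability"
begin

section \<open>Path functionals\<close>

definition jump :: "(real \<Rightarrow> real) \<Rightarrow> real \<Rightarrow> real" where
  "jump z t = z t - Lim (at_left t) z"

text \<open>
  The function vanishing at \<open>0\<close> whose increment over \<open>(s,t]\<close> is the sum of \<open>f\<close> over \<open>(s,t]\<close>.
  It is applied to functions that are nonzero at countably many points only and
  absolutely summable over bounded intervals.
\<close>

definition signed_sum :: "(real \<Rightarrow> real) \<Rightarrow> real \<Rightarrow> real" where
  "signed_sum f t =
     (if 0 \<le> t then (\<Sum>\<^sub>\<infinity>u\<in>{0<..t}. f u) else - (\<Sum>\<^sub>\<infinity>u\<in>{t<..0}. f u))"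

definition cont_part :: "(real \<Rightarrow> real) \<Rightarrow> real \<Rightarrow> real" where
  "cont_part z t = z t - z 0 - signed_sum (jump z) t"

definition J_path :: "(real \<Rightarrow> real) \<Rightarrow> real \<Rightarrow> real" where
  "J_path z t =
     cont_part z t - signed_sum (\<lambda>u. if jump z u < 1 then ln (1 - jump z u) else 0) t"

definition N_path :: "(real \<Rightarrow> real) \<Rightarrow> real \<Rightarrow> real" where
  "N_path z t = signed_sum (\<lambda>u. if jump z u = 1 then 1 else 0) t"

text \<open>The infimum is taken in the extended reals, where \<open>Inf {} = \<infinity>\<close>.\<close>

definition T1_path :: "(real \<Rightarrow> real) \<Rightarrow> ereal" where
  "T1_path z = Inf (ereal ` {t. 0 < t \<and> jump z t = 1})"

text \<open>
  For nondecreasing paths all sums involved converge, and the functionals have the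
  increments that characterise them (together with vanishing at \<open>0\<close>).
\<close>

lemma left_limit_mono:
  fixes z :: "real \<Rightarrow> real"
  assumes "mono z"
  shows "(z \<longlongrightarrow> Lim (at_left t) z) (at_left t)"
proof -
  have "(z \<longlongrightarrow> Sup (z ` ({..<t} \<inter> UNIV))) (at t within ({..<t} \<inter> UNIV))"
    by (rule Lim_left_bound[where K = "z t"]) (auto intro: monoD[OF assms])
  then show ?thesis
    by (simp add: tendsto_Lim)
qed

lemma left_limit_bounds:
  fixes z :: "real \<Rightarrow> real"
  assumes "mono z"
  shows "Lim (at_left t) z \<le> z t" and "s < t \<Longrightarrow> z s \<le> Lim (at_left t) z"
proof -
  show "Lim (at_left t) z \<le> z t"
    by (rule tendsto_upperbound[OF left_limit_mono[OF assms]])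
      (auto simp: eventually_at_filter intro!: always_eventually monoD[OF assms])
  assume "s < t"
  then have "eventually (\<lambda>u. z s \<le> z u) (at_left t)"
    unfolding eventually_at_left_field by (intro exI[of _ s]) (auto intro: monoD[OF assms])
  then show "z s \<le> Lim (at_left t) z"
    by (rule tendsto_lowerbound[OF left_limit_mono[OF assms]]) simp
qed

lemma jump_nonneg: "mono z \<Longrightarrow> 0 \<le> jump z t"
  using left_limit_bounds(1) by (simp add: jump_def)

lemma sum_jump_le:
  assumes "mono z" "finite F" "F \<subseteq> {s<..t}" "s \<le> t"
  shows "sum (jump z) F \<le> z t - z s"
  using assms(2-4)
proof (induction F arbitrary: t rule: finite_linorder_max_induct)
  case empty
  then show ?case using monoD[OF assms(1)] by simp
next
  case (insert b A)
  define m where "m = Max (insert s A)"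
  have "m < b" "s \<le> m" "A \<subseteq> {s<..m}"
    using insert by (auto simp: m_def)
  with insert.IH have "sum (jump z) A \<le> z m - z s" by blast
  also have "z m \<le> Lim (at_left b) z"
    using left_limit_bounds(2)[OF assms(1) \<open>m < b\<close>] .
  finally have "sum (jump z) A + jump z b \<le> z b - z s"
    by (simp add: jump_def)
  moreover have "z b \<le> z t"
    using insert.prems by (auto intro: monoD[OF assms(1)])
  moreover have "b \<notin> A" using insert.hyps by auto
  ultimately show ?case using insert.hyps by simp
qed

lemma jump_summable:
  assumes "mono z"
  shows "jump z summable_on {s<..t}"
proof (cases "s \<le> t")
  case True
  show ?thesis
    using sum_jump_le[OF assms _ _ True] jump_nonneg[OF assms]
    by (intro nonneg_bdd_above_summable_on bdd_aboveI[where M = "z t - z s"]) auto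
qed simp

lemma finite_large_jumps:
  assumes "mono z"
  shows "finite {u \<in> {s<..t}. 1/2 < jump z u}"
proof (cases "s \<le> t")
  case True
  show ?thesis
  proof (rule finite_if_finite_subsets_card_bdd[where C = "nat \<lceil>2 * (z t - z s)\<rceil>", THEN conjunct1])
    fix F assume F: "F \<subseteq> {u \<in> {s<..t}. 1/2 < jump z u}" "finite F"
    have "real (card F) * (1/2) \<le> sum (jump z) F"
      using F by (intro sum_bounded_below) auto
    also have "\<dots> \<le> z t - z s"
      using F by (intro sum_jump_le[OF assms _ _ True]) auto
    finally have "real (card F) \<le> 2 * (z t - z s)" by simp
    then show "card F \<le> nat \<lceil>2 * (z t - z s)\<rceil>" by linarith
  qed
qed simp

lemma log_jump_summable:
  assumes "mono z"
  shows "(\<lambda>u. if jump z u < 1 then ln (1 - jump z u) else 0) summable_on {s<..t}"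
    (is "?f summable_on _")
proof -
  let ?B = "{u \<in> {s<..t}. 1/2 < jump z u}"
  have "(\<lambda>u. - ?f u) summable_on {s<..t} - ?B"
  proof (rule summable_on_comparison_test)
    show "(\<lambda>u. 2 * jump z u) summable_on {s<..t} - ?B"
      by (intro summable_on_cmult_right summable_on_subset_banach[OF jump_summable[OF assms]]) auto
    fix u assume "u \<in> {s<..t} - ?B"
    then have u: "0 \<le> jump z u" "jump z u \<le> 1/2"
      using jump_nonneg[OF assms] by auto
    have "- jump z u - 2 * (jump z u)\<^sup>2 \<le> ln (1 - jump z u)"
      using ln_one_minus_pos_lower_bound[OF u] .
    moreover have "2 * (jump z u)\<^sup>2 \<le> jump z u"
      using mult_left_mono[OF u(2,1)] by (simp add: power2_eq_square)
    ultimately show "- ?f u \<le> 2 * jump z u" using u by auto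
    show "0 \<le> - ?f u" using u by auto
  qed
  then have "?f summable_on {s<..t} - ?B"
    by (simp only: summable_on_uminus)
  moreover have "?f summable_on ?B"
    using finite_large_jumps[OF assms] by (rule summable_on_finite)
  ultimately have "?f summable_on (({s<..t} - ?B) \<union> ?B)"
    by (rule summable_on_Un_disjoint) auto
  also have "({s<..t} - ?B) \<union> ?B = {s<..t}" by auto
  finally show ?thesis .
qed

lemma unit_jump_summable:
  assumes "mono z"
  shows "(\<lambda>u. if jump z u = 1 then 1 else 0 :: real) summable_on {s<..t}"
  by (rule finite_nonzero_values_imp_summable_on)
    (auto intro: finite_subset[OF _ finite_large_jumps[OF assms, of s t]])

lemma signed_sum_increment:
  assumes f: "\<And>a b. f summable_on {a<..b}" and "s \<le> t"
  shows "signed_sum f t - signed_sum f s = (\<Sum>\<^sub>\<infinity>u\<in>{s<..t}. f u)"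
proof -
  have split: "infsum f {a<..c} = infsum f {a<..b} + infsum f {b<..c}"
    if "a \<le> b" "b \<le> c" for a b c
  proof -
    have "{a<..c} = {a<..b} \<union> {b<..c}" using that by auto
    then show ?thesis by (simp add: infsum_Un_disjoint[OF f f])
  qed
  show ?thesis
    using split[of 0 s t] split[of s 0 t] split[of s t 0] \<open>s \<le> t\<close>
    by (auto simp: signed_sum_def)
qed

lemma path_increments:
  assumes "mono z" "s \<le> t"
  shows "cont_part z t - cont_part z s = z t - z s - (\<Sum>\<^sub>\<infinity>u\<in>{s<..t}. jump z u)"
    and "J_path z t - J_path z s = cont_part z t - cont_part z s
           - (\<Sum>\<^sub>\<infinity>u\<in>{s<..t}. if jump z u < 1 then ln (1 - jump z u) else 0)"
    and "N_path z t - N_path z s = (\<Sum>\<^sub>\<infinity>u\<in>{s<..t}. if jump z u = 1 then 1 else 0)"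
  using signed_sum_increment[OF jump_summable[OF assms(1)] assms(2)]
    signed_sum_increment[OF log_jump_summable[OF assms(1)] assms(2)]
    signed_sum_increment[OF unit_jump_summable[OF assms(1)] assms(2)]
  by (simp_all add: cont_part_def J_path_def N_path_def)

section \<open>The processes \<open>X\<close> and \<open>X\<^sup>*\<close>\<close>

text \<open>
  Processes are functions \<open>real \<Rightarrow> 'a \<Rightarrow> real\<close>, time first. For processes with time set
  \<open>[0,\<infinity>)\<close> the values at negative times are never used.
\<close>

definition cadlag_nonneg :: "(real \<Rightarrow> real) \<Rightarrow> bool" where
  "cadlag_nonneg x \<longleftrightarrow>
     (\<forall>t\<ge>0. continuous (at_right t) x) \<and> (\<forall>t>0. \<exists>l. (x \<longlongrightarrow> l) (at_left t))"

text \<open>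
  The process \<open>X\<close> solves \<open>X\<^sub>t = X0 + Y\<^sub>t - \<integral>\<^bsub>(0,t]\<^esub> X\<^bsub>s-\<^esub> dZ\<^sub>s\<close>, \<open>t \<ge> 0\<close>, almost surely. For a
  cadlag path the integrand is a bounded Borel function on \<open>(0,t]\<close>, so the integral exists.
\<close>

definition solves ::
  "'a measure \<Rightarrow> (real \<Rightarrow> 'a \<Rightarrow> real) \<Rightarrow> (real \<Rightarrow> 'a \<Rightarrow> real) \<Rightarrow> ('a \<Rightarrow> real) \<Rightarrow>
   (real \<Rightarrow> 'a \<Rightarrow> real) \<Rightarrow> bool" where
  "solves M Y Z X0 X \<longleftrightarrow>
     (\<forall>t\<ge>0. X t \<in> borel_measurable M) \<and>
     (AE \<omega> in M. cadlag_nonneg (\<lambda>t. X t \<omega>) \<and>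
        (\<forall>t\<ge>0. X t \<omega> = X0 \<omega> + Y t \<omega> -
           (LINT s:{0<..t}|interval_measure (\<lambda>s. Z s \<omega>). Lim (at_left s) (\<lambda>u. X u \<omega>))))"

definition X_star ::
  "(real \<Rightarrow> 'a \<Rightarrow> real) \<Rightarrow> (real \<Rightarrow> 'a \<Rightarrow> real) \<Rightarrow> real \<Rightarrow> 'a \<Rightarrow> real" where
  "X_star Y Z t \<omega> =
     (let J = J_path (\<lambda>s. Z s \<omega>); N = N_path (\<lambda>s. Z s \<omega>)
      in LINT s:{..t}|interval_measure (\<lambda>s. Y s \<omega>).
           exp (- (J t - J s)) * indicator {s. N t - N s = 0} s)"

section \<open>Laws, stationarity, convergence\<close>

definition jointly_stationary_increments ::
  "'a measure \<Rightarrow> (real \<Rightarrow> 'a \<Rightarrow> real) \<Rightarrow> (real \<Rightarrow> 'a \<Rightarrow> real) \<Rightarrow> bool" where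
  "jointly_stationary_increments M Y Z \<longleftrightarrow>
     (let law = (\<lambda>s. distr M (\<Pi>\<^sub>M t\<in>(UNIV :: real set). (borel :: (real \<times> real) measure))
                       (\<lambda>\<omega> t. (Y (t + s) \<omega> - Y s \<omega>, Z (t + s) \<omega> - Z s \<omega>)))
      in \<forall>s s'. law s = law s')"

definition law_nonneg ::
  "'a measure \<Rightarrow> (real \<Rightarrow> 'a \<Rightarrow> real) \<Rightarrow> (real \<Rightarrow> real) measure" where
  "law_nonneg M X =
     distr M (\<Pi>\<^sub>M t\<in>{0..}. (borel :: real measure)) (\<lambda>\<omega>. \<lambda>t\<in>{0..}. X t \<omega>)"

definition stationary_nonneg :: "'a measure \<Rightarrow> (real \<Rightarrow> 'a \<Rightarrow> real) \<Rightarrow> bool" where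
  "stationary_nonneg M X \<longleftrightarrow> (\<forall>s\<ge>0. law_nonneg M (\<lambda>t. X (t + s)) = law_nonneg M X)"

definition stationary_version ::
  "'a measure \<Rightarrow> (real \<Rightarrow> 'a \<Rightarrow> real) \<Rightarrow> (real \<Rightarrow> 'a \<Rightarrow> real) \<Rightarrow>
   (real \<Rightarrow> 'a \<Rightarrow> real) \<Rightarrow> bool" where
  "stationary_version M Y Z X \<longleftrightarrow> solves M Y Z (X 0) X \<and> stationary_nonneg M X"

text \<open>
  The continuous-time analogue of \<^const>\<open>weak_conv_m\<close>, which is restricted to sequences.
\<close>

definition converges_in_distribution ::
  "'a measure \<Rightarrow> (real \<Rightarrow> 'a \<Rightarrow> real) \<Rightarrow> ('a \<Rightarrow> real) \<Rightarrow> bool" where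
  "converges_in_distribution M X L \<longleftrightarrow>
     (\<forall>x. isCont (cdf (distr M borel L)) x \<longrightarrow>
        ((\<lambda>t. cdf (distr M borel (X t)) x) \<longlongrightarrow> cdf (distr M borel L) x) at_top)"

definition stochastically_increasing :: "'a measure \<Rightarrow> (real \<Rightarrow> 'a \<Rightarrow> real) \<Rightarrow> bool" where
  "stochastically_increasing M X \<longleftrightarrow>
     (\<forall>a. mono_on {0..} (\<lambda>t. measure M {\<omega> \<in> space M. X t \<omega> > a}))"

end

theory Submission
  imports Defs
begin

text \<open>
  The equation is solved by the flow
  \<open>X\<^sub>t = E(a,t) X\<^sub>a + \<integral>\<^bsub>(a,t]\<^esub> E(s,t) dY\<^sub>s\<close> with
  \<open>E(s,t) = e\<^bsup>-(J\<^sub>t - J\<^sub>s)\<^esup> 1\<^bsub>{N\<^sub>t = N\<^sub>s}\<^esub>\<close>. The only properties of \<open>E\<close> this needs are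
  multiplicativity, \<open>1 - \<delta> \<le> E(s,t) \<le> 1 - \<delta> + \<delta>\<^sup>2\<close> for \<open>\<delta> = Z\<^sub>t - Z\<^sub>s\<close>, and
  \<open>E(s,t) \<le> 1 - \<Delta>Z\<^sub>u\<close> for \<open>s < u \<le> t\<close>.

  All solutions share the inflow \<open>V(0,t) = \<integral>\<^bsub>(0,t]\<^esub> E(s,t) dY\<^sub>s\<close> and differ by \<open>E(0,t)\<close> times the
  difference of their initial values, which tends to \<open>0\<close> under either alternative of the last
  hypothesis. Stationarity of the increments gives \<open>V(0,t)\<close> the law of \<open>V(-t,0)\<close>, and
  \<open>V(-t,0)\<close> increases pathwise to \<open>X\<^sup>*\<^sub>0\<close>.
\<close>

section \<open>Right-continuous nondecreasing paths\<close>

text \<open>\<open>J_path\<close> and \<open>N_path\<close> are built from sums over uncountable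
  sets of times, so neither their measurability in the path nor their behaviour under time shifts
  can be read off. Both questions are settled for \<open>E\<close> alone, which is recovered as a
  product integral of \<open>1 - dZ\<close>: the limit, over refining grids, of the products of
  \<open>max 0 (1 - \<delta>)\<close>. The two bounds in \<open>\<delta>\<close> make the error of
  one factor at most \<open>\<delta>\<^sup>2\<close>; this is negligible where \<open>Z\<close> is
  continuous, but not in cells around a jump of fixed size, and there the bound by
  \<open>1 - \<Delta>Z\<close> takes over. Nothing is assumed about the dependence between
  \<open>X0\<close> and \<open>(Y,Z)\<close>, so uniqueness of the stationary law cannot come from a
  Markov or independence argument; it rests on pathwise merging of solutions. The identity in law
  between \<open>V(0,t)\<close> and \<open>V(-t,0)\<close> concerns each \<open>t\<close>
  separately. The second family is monotone in \<open>t\<close>, and this monotonicity both gives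
  the stochastic order and turns limits along the integers into limits along the reals.\<close>

definition stieltjes :: "(real \<Rightarrow> real) \<Rightarrow> bool" where
  "stieltjes F \<longleftrightarrow> mono F \<and> (\<forall>t. continuous (at_right t) F)"

lemma stieltjesD:
  assumes "stieltjes F"
  shows "mono F" "\<And>s t. s \<le> t \<Longrightarrow> F s \<le> F t" "\<And>t. continuous (at_right t) F"
    "\<And>t. (F \<longlongrightarrow> F t) (at_right t)"
  using assms by (auto simp: stieltjes_def continuous_within intro: monoD)

text \<open>The sequence may hit \<open>t\<close> itself, as right grid points do, so the limit is
  taken within \<open>{t..}\<close> instead of along \<open>at_right t\<close>.\<close>

lemma right_continuous_sequence:
  fixes f :: "real \<Rightarrow> real"
  assumes "continuous (at_right t) f" and "x \<longlonglongrightarrow> t" and "\<And>n. t \<le> x n"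
  shows "(\<lambda>n. f (x n)) \<longlonglongrightarrow> f t"
proof -
  have "(f \<longlongrightarrow> f t) (at t within {t..})"
    using assms(1) by (simp add: continuous_within at_within_Ici_at_right)
  then have "continuous (at t within {t..}) f"
    by (simp add: continuous_within)
  then show ?thesis
    using assms(2,3) by (auto simp: continuous_within_sequentially o_def)
qed

lemma left_limit_sequence:
  fixes f :: "real \<Rightarrow> real"
  assumes "(f \<longlongrightarrow> l) (at_left t)" and "x \<longlonglongrightarrow> t" and "\<And>n. x n < t"
  shows "(\<lambda>n. f (x n)) \<longlonglongrightarrow> l"
  using assms(1)
  by (rule filterlim_compose) (use assms(2,3) in \<open>auto simp: filterlim_at less_imp_neq\<close>)

text \<open>Continuous induction. At the infimum of the failures, \<open>left\<close> supplies the
  property and \<open>right\<close> carries it beyond, a contradiction. Estimates local to each time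
  thus suffice, and jumps are dealt with in the \<open>left\<close> case only.\<close>

lemma real_induct_ge [consumes 1, case_names right left]:
  fixes a t :: real
  assumes "a \<le> t"
    and right: "\<And>t. a \<le> t \<Longrightarrow> (\<And>s. a \<le> s \<Longrightarrow> s \<le> t \<Longrightarrow> P s) \<Longrightarrow> \<forall>\<^sub>F s in at_right t. P s"
    and left: "\<And>t. a \<le> t \<Longrightarrow> (\<And>s. a \<le> s \<Longrightarrow> s < t \<Longrightarrow> P s) \<Longrightarrow> P t"
  shows "P t"
proof (rule ccontr)
  define B where "B = {s. a \<le> s \<and> \<not> P s}"
  assume "\<not> P t"
  then have "B \<noteq> {}" "bdd_below B" using assms(1) by (auto simp: B_def intro: bdd_belowI)
  define c where "c = Inf B"
  have "a \<le> c" unfolding c_def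
    by (rule cInf_greatest[OF \<open>B \<noteq> {}\<close>]) (auto simp: B_def)
  have below: "P s" if "a \<le> s" "s < c" for s
    using cInf_lower[OF _ \<open>bdd_below B\<close>, of s] that by (auto simp: B_def c_def)
  then have "P c" using left[OF \<open>a \<le> c\<close>] by blast
  then have "P s" if "a \<le> s" "s \<le> c" for s using below that by (cases "s = c") auto
  from right[OF \<open>a \<le> c\<close> this] obtain d where d: "d > c" "\<And>s. c < s \<Longrightarrow> s < d \<Longrightarrow> P s"
    by (auto simp: eventually_at_right_field)
  obtain s where "s \<in> B" "s < d"
    using cInf_lessD[OF \<open>B \<noteq> {}\<close>, of d] d(1) by (auto simp: c_def)
  then show False
    using below[of s] d(2)[of s] \<open>P c\<close> by (cases s c rule: linorder_cases) (auto simp: B_def)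
qed

section \<open>The damping factor\<close>

text \<open>Literally the integrand of \<open>X_star\<close>, so that the link to it is pure
  unfolding. It is the proportion of mass present at time \<open>s\<close> that survives up to time
  \<open>t\<close>; a unit jump of \<open>z\<close> destroys everything.\<close>

definition damp :: "(real \<Rightarrow> real) \<Rightarrow> real \<Rightarrow> real \<Rightarrow> real" where
  "damp z s t =
     exp (- (J_path z t - J_path z s)) * indicator {s. N_path z t - N_path z s = 0} s"

text \<open>Multiply by \<open>exp x\<close>, which is at least \<open>1 + x\<close>, and use
  \<open>(1 - x + x^2) * (1 + x) = 1 + x^3\<close>.\<close>

lemma exp_minus_le_quadratic:
  fixes x :: real
  assumes "0 \<le> x"
  shows "exp (- x) \<le> 1 - x + x\<^sup>2"
proof -
  have "1 \<le> (1 - x + x\<^sup>2) * (1 + x)"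
    using assms by (simp add: algebra_simps power2_eq_square)
  also have "\<dots> \<le> (1 - x + x\<^sup>2) * exp x"
  proof (rule mult_left_mono)
    have "1 - x + x\<^sup>2 = (1 - x)\<^sup>2 + x" by (simp add: power2_eq_square algebra_simps)
    moreover have "0 \<le> (1 - x)\<^sup>2 + x" using assms by simp
    ultimately show "0 \<le> 1 - x + x\<^sup>2" by (simp only:)
  qed simp
  finally show ?thesis by (simp add: exp_minus field_simps)
qed

lemma infsum_jump_le: "mono z \<Longrightarrow> s \<le> t \<Longrightarrow> (\<Sum>\<^sub>\<infinity>u\<in>{s<..t}. jump z u) \<le> z t - z s"
  by (intro infsum_le_finite_sums jump_summable sum_jump_le)

locale damping_path =
  fixes z :: "real \<Rightarrow> real"
  assumes stieltjes: "stieltjes z" and jump_le_1: "jump z t \<le> 1"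
begin

lemmas mono_z = stieltjesD(1)[OF stieltjes]
  and z_le = stieltjesD(2)[OF stieltjes]

text \<open>The sign makes all terms nonnegative, so finite partial sums bound the infinite sum from
  below. A unit jump contributes \<open>0\<close> because \<open>N_path\<close> accounts for
  it.\<close>

abbreviation logjump :: "real \<Rightarrow> real" where
  "logjump u \<equiv> - (if jump z u < 1 then ln (1 - jump z u) else 0)"

lemma logjump_nonneg: "0 \<le> logjump u"
  using jump_nonneg[OF mono_z, of u] by auto

lemma logjump_summable: "logjump summable_on {s<..t}"
  using log_jump_summable[OF mono_z, of s t] by (simp only: summable_on_uminus)

lemma J_increment:
  assumes "s \<le> t"
  shows "J_path z t - J_path z s =
    (z t - z s - (\<Sum>\<^sub>\<infinity>u\<in>{s<..t}. jump z u)) + (\<Sum>\<^sub>\<infinity>u\<in>{s<..t}. logjump u)"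
  using path_increments(1,2)[OF mono_z assms] by (simp only: infsum_uminus)

lemma jump_le_increment: "u \<in> {s<..t} \<Longrightarrow> jump z u \<le> z t - z s"
  using sum_jump_le[OF mono_z, of "{u}" s t] by simp

lemma J_mono: "mono (J_path z)"
proof (rule monoI)
  fix s t :: real assume "s \<le> t"
  have "0 \<le> infsum logjump {s<..t}"
    by (rule infsum_nonneg) (rule logjump_nonneg)
  then show "J_path z s \<le> J_path z t"
    using J_increment[OF \<open>s \<le> t\<close>] infsum_jump_le[OF mono_z \<open>s \<le> t\<close>] by linarith
qed

lemma N_mono: "mono (N_path z)"
proof (rule monoI)
  fix s t :: real assume "s \<le> t"
  have "0 \<le> (\<Sum>\<^sub>\<infinity>u\<in>{s<..t}. if jump z u = 1 then 1 else 0 :: real)"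
    by (intro infsum_nonneg) auto
  then show "N_path z s \<le> N_path z t"
    using path_increments(3)[OF mono_z \<open>s \<le> t\<close>] by linarith
qed

lemma damp_refl [simp]: "damp z t t = 1"
  by (simp add: damp_def)

lemma damp_nonneg: "0 \<le> damp z s t"
  by (simp add: damp_def)

text \<open>As \<open>N_path z\<close> is nondecreasing, its increment over the whole interval
  vanishes exactly when the increments over both pieces do.\<close>

lemma damp_mult:
  assumes "a \<le> b" "b \<le> c"
  shows "damp z a c = damp z a b * damp z b c"
proof -
  have "N_path z c - N_path z a = 0 \<longleftrightarrow> N_path z b - N_path z a = 0 \<and> N_path z c - N_path z b = 0"
    using monoD[OF N_mono assms(1)] monoD[OF N_mono assms(2)] by linarith
  moreover have "exp (- (J_path z c - J_path z a)) =
      exp (- (J_path z b - J_path z a)) * exp (- (J_path z c - J_path z b))"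
    by (simp flip: exp_add)
  ultimately show ?thesis
    by (cases "N_path z c - N_path z a = 0") (auto simp: damp_def indicator_def)
qed

lemma damp_eq_0:
  assumes "u \<in> {s<..t}" "jump z u = 1"
  shows "damp z s t = 0"
proof -
  let ?f = "\<lambda>u. if jump z u = 1 then 1 else 0 :: real"
  have "sum ?f {u} \<le> infsum ?f {s<..t}"
    by (rule finite_sum_le_infsum[OF unit_jump_summable[OF mono_z]]) (use assms in auto)
  then have "1 \<le> N_path z t - N_path z s"
    using assms path_increments(3)[OF mono_z, of s t] by auto
  then show ?thesis by (auto simp: damp_def)
qed

lemma damp_eq_exp:
  assumes "\<And>u. u \<in> {s<..t} \<Longrightarrow> jump z u \<noteq> 1" "s \<le> t"
  shows "damp z s t = exp (- (J_path z t - J_path z s))"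
proof -
  have "(\<Sum>\<^sub>\<infinity>u\<in>{s<..t}. if jump z u = 1 then 1 else 0 :: real) = 0"
    by (rule infsum_0) (use assms in auto)
  then show ?thesis
    using path_increments(3)[OF mono_z \<open>s \<le> t\<close>] by (simp add: damp_def)
qed

text \<open>One term of the nonnegative logarithmic sum already bounds the increment of
  \<open>J_path z\<close> from below, and a unit jump makes \<open>damp\<close> vanish. This is the
  estimate for short intervals containing a large jump, where the quadratic term of
  \<open>damp_upper\<close> does not become small.\<close>

lemma damp_le_1_minus_jump:
  assumes "u \<in> {s<..t}"
  shows "damp z s t \<le> 1 - jump z u"
proof (cases "\<exists>v\<in>{s<..t}. jump z v = 1")
  case True
  then show ?thesis using damp_eq_0 jump_le_1[of u] by auto
next
  case False
  then have "jump z u < 1" using assms jump_le_1[of u] by force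
  have "sum logjump {u} \<le> infsum logjump {s<..t}"
    by (rule finite_sum_le_infsum[OF logjump_summable]) (use assms logjump_nonneg in auto)
  then have "- ln (1 - jump z u) \<le> J_path z t - J_path z s"
    using J_increment[of s t] infsum_jump_le[OF mono_z, of s t] assms \<open>jump z u < 1\<close> by auto
  then have "exp (- (J_path z t - J_path z s)) \<le> exp (ln (1 - jump z u))"
    by simp
  then show ?thesis
    using damp_eq_exp[of s t] False assms \<open>jump z u < 1\<close> by auto
qed

lemma damp_le_1: "s \<le> t \<Longrightarrow> damp z s t \<le> 1"
  using monoD[OF J_mono, of s t] by (auto simp: damp_def indicator_def)

text \<open>If there is a unit jump or the jumps sum to \<open>S \<ge> 1\<close>, the left side is
  at most \<open>0\<close>. Otherwise the jumps contribute a factor of at least \<open>1 - S\<close>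
  by Weierstrass' product inequality, the continuous increment \<open>r\<close> contributes
  \<open>exp (- r) \<ge> 1 - r\<close>, and
  \<open>(1 - r) * (1 - S) \<ge> 1 - r - S\<close>.\<close>

lemma damp_lower:
  assumes "s \<le> t"
  shows "1 - (z t - z s) \<le> damp z s t"
proof (cases "\<exists>u\<in>{s<..t}. jump z u = 1")
  case True
  then show ?thesis
    using jump_le_increment damp_nonneg[of s t] by force
next
  case False
  let ?S = "\<Sum>\<^sub>\<infinity>u\<in>{s<..t}. jump z u"
  have S: "0 \<le> ?S" "?S \<le> z t - z s"
    using infsum_jump_le[OF mono_z assms] jump_nonneg[OF mono_z] by (auto intro: infsum_nonneg)
  show ?thesis
  proof (cases "?S < 1")
    case True
    have "infsum logjump {s<..t} \<le> - ln (1 - ?S)"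
    proof (rule infsum_le_finite_sums[OF logjump_summable])
      fix F assume F: "finite F" "F \<subseteq> {s<..t}"
      have lt1: "jump z u < 1" if "u \<in> F" for u
        using that F False jump_le_1[of u] by force
      have "1 - ?S \<le> 1 - sum (jump z) F"
        using finite_sum_le_infsum[OF jump_summable[OF mono_z] F] jump_nonneg[OF mono_z] by auto
      also have "\<dots> \<le> (\<Prod>u\<in>F. 1 - jump z u)"
        by (rule Weierstrass_prod_ineq) (use jump_nonneg[OF mono_z] jump_le_1 in auto)
      finally have "ln (1 - ?S) \<le> ln (\<Prod>u\<in>F. 1 - jump z u)"
        using True by (subst ln_le_cancel_iff) auto
      also have "\<dots> = (\<Sum>u\<in>F. ln (1 - jump z u))"
        using F lt1 by (intro ln_prod) force+
      also have "\<dots> = - sum logjump F"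
        using lt1 by (simp add: sum_negf)
      finally show "sum logjump F \<le> - ln (1 - ?S)" by simp
    qed
    then have "J_path z t - J_path z s \<le> (z t - z s - ?S) - ln (1 - ?S)"
      using J_increment[OF assms] by linarith
    then have "exp (- (z t - z s - ?S) + ln (1 - ?S)) \<le> damp z s t"
      using damp_eq_exp[of s t] False assms by auto
    then have "exp (- (z t - z s - ?S)) * (1 - ?S) \<le> damp z s t"
      using True by (simp add: exp_add)
    moreover have "1 - (z t - z s - ?S) \<le> exp (- (z t - z s - ?S))"
      using exp_ge_add_one_self[of "- (z t - z s - ?S)"] by linarith
    then have "(1 - (z t - z s - ?S)) * (1 - ?S) \<le> exp (- (z t - z s - ?S)) * (1 - ?S)"
      using True by (intro mult_right_mono) auto
    moreover have "1 - (z t - z s) \<le> (1 - (z t - z s - ?S)) * (1 - ?S)"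
      using mult_nonneg_nonneg[OF S(1), of "z t - z s - ?S"] S(2) by (simp add: algebra_simps)
    ultimately show ?thesis by linarith
  next
    case False
    then show ?thesis using S(2) damp_nonneg[of s t] by linarith
  qed
qed

text \<open>Without unit jumps, \<open>- ln (1 - x) \<ge> x\<close> lets \<open>J_path z\<close>
  grow at least as fast as \<open>z\<close>, so \<open>damp\<close> is at most \<open>exp\<close> of
  minus the increment of \<open>z\<close>. With a unit jump \<open>damp\<close> is \<open>0\<close>,
  and the increment is at least \<open>1\<close>.\<close>

lemma damp_upper:
  assumes "s \<le> t"
  shows "damp z s t \<le> 1 - (z t - z s) + (z t - z s)\<^sup>2"
proof (cases "\<exists>u\<in>{s<..t}. jump z u = 1")
  case True
  then have "1 \<le> z t - z s" using jump_le_increment by force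
  then have "z t - z s \<le> (z t - z s)\<^sup>2" by (simp add: power2_eq_square)
  then show ?thesis using True damp_eq_0 by auto
next
  case False
  have "(\<Sum>\<^sub>\<infinity>u\<in>{s<..t}. jump z u) \<le> infsum logjump {s<..t}"
  proof (rule infsum_mono[OF jump_summable[OF mono_z] logjump_summable])
    fix u assume "u \<in> {s<..t}"
    then have "jump z u < 1" using False jump_le_1[of u] by force
    then show "jump z u \<le> logjump u"
      using ln_le_minus_one[of "1 - jump z u"] by simp
  qed
  then have "damp z s t \<le> exp (- (z t - z s))"
    using J_increment[OF assms] damp_eq_exp[of s t] False assms by auto
  also have "\<dots> \<le> 1 - (z t - z s) + (z t - z s)\<^sup>2"
    using z_le[OF assms] by (intro exp_minus_le_quadratic) simp
  finally show ?thesis .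
qed

lemma damp_antimono_right: "a \<le> b \<Longrightarrow> b \<le> c \<Longrightarrow> damp z a c \<le> damp z a b"
  using damp_mult[of a b c] damp_le_1[of b c] damp_nonneg[of a b]
  by (simp add: mult_left_le)

lemma damp_mono_left: "a \<le> b \<Longrightarrow> b \<le> c \<Longrightarrow> damp z a c \<le> damp z b c"
  using damp_mult[of a b c] damp_le_1[of a b] damp_nonneg[of b c]
  by (simp add: mult_left_le_one_le damp_nonneg)

lemma damp_left_measurable [measurable]: "(\<lambda>s. damp z s t) \<in> borel_measurable borel"
proof -
  note borel_measurable_mono[OF J_mono, measurable] borel_measurable_mono[OF N_mono, measurable]
  have "damp z s t = exp (- (J_path z t - J_path z s)) * (if N_path z t - N_path z s = 0 then 1 else 0)"
    for s
    by (simp add: damp_def indicator_def)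
  then show ?thesis by simp
qed

end

section \<open>Riemann--Stieltjes sums\<close>

lemma emeasure_stieltjes_Ioc:
  "stieltjes F \<Longrightarrow> a \<le> b \<Longrightarrow> emeasure (interval_measure F) {a<..b} = ennreal (F b - F a)"
  by (rule emeasure_interval_measure_Ioc) (auto dest: stieltjesD)

lemma measure_stieltjes_Ioc:
  "stieltjes F \<Longrightarrow> a \<le> b \<Longrightarrow> measure (interval_measure F) {a<..b} = F b - F a"
  by (rule measure_interval_measure_Ioc) (auto dest: stieltjesD)

lemma set_integrable_const_Ioc:
  "stieltjes F \<Longrightarrow> set_integrable (interval_measure F) {a<..b} (\<lambda>_. c :: real)"
  by (cases "a \<le> b")
    (auto simp: set_integrable_def emeasure_stieltjes_Ioc intro!: integrable_mult_right
      integrable_real_mult_indicator)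

lemma set_integral_const_Ioc:
  "stieltjes F \<Longrightarrow> a \<le> b \<Longrightarrow> (LINT u:{a<..b}|interval_measure F. c :: real) = c * (F b - F a)"
  by (simp add: set_lebesgue_integral_def measure_stieltjes_Ioc)

lemma set_integrable_bounded_Ioc:
  fixes f :: "real \<Rightarrow> real"
  assumes "stieltjes F" "f \<in> borel_measurable borel" "\<And>u. u \<in> {a<..b} \<Longrightarrow> \<bar>f u\<bar> \<le> B"
  shows "set_integrable (interval_measure F) {a<..b} f"
  by (rule set_integrable_bound[OF set_integrable_const_Ioc[OF assms(1), of a b B]])
    (use assms(2,3) in \<open>force simp: set_borel_measurable_def\<close>)+

lemma set_integral_split_Ioc:
  fixes f :: "real \<Rightarrow> real"
  assumes "set_integrable (interval_measure F) {a<..c} f" "a \<le> b" "b \<le> c"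
  shows "(LINT u:{a<..c}|interval_measure F. f u) =
    (LINT u:{a<..b}|interval_measure F. f u) + (LINT u:{b<..c}|interval_measure F. f u)"
proof -
  have eq: "{a<..c} = {a<..b} \<union> {b<..c}" using assms by auto
  show ?thesis unfolding eq
    by (rule set_integral_Un) (use assms in \<open>auto intro: set_integrable_subset\<close>)
qed

text \<open>Index \<open>n\<close> stands for \<open>n + 1\<close> cells, so the denominator never
  vanishes and limits in \<open>n\<close> start at \<open>0\<close>.\<close>

definition grid :: "real \<Rightarrow> real \<Rightarrow> nat \<Rightarrow> nat \<Rightarrow> real" where
  "grid a b n i = a + (b - a) * real i / real (Suc n)"

lemma grid_0 [simp]: "grid a b n 0 = a"
  and grid_Suc_self [simp]: "grid a b n (Suc n) = b"
  by (simp_all add: grid_def)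

lemma grid_mono: "a \<le> b \<Longrightarrow> i \<le> j \<Longrightarrow> grid a b n i \<le> grid a b n j"
  by (auto simp: grid_def intro!: divide_right_mono mult_left_mono)

lemma grid_bounds:
  assumes "a \<le> b" "i \<le> Suc n"
  shows "a \<le> grid a b n i" "grid a b n i \<le> b"
  using grid_mono[OF assms(1), of 0 i n] grid_mono[OF assms(1,2), of n] by simp_all

lemma grid_shift: "grid (a + s) (b + s) n i = grid a b n i + s"
  by (simp add: grid_def)

lemma grid_cell:
  assumes "u \<in> {a<..b}"
  shows "\<exists>!i. i \<le> n \<and> u \<in> {grid a b n i<..grid a b n (Suc i)}"
proof (rule ex_ex1I)
  have ab: "a < b" using assms by auto
  define i where "i = (LEAST i. u \<le> grid a b n i)"
  have le: "u \<le> grid a b n i" unfolding i_def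
    by (rule LeastI[of _ "Suc n"]) (use assms in simp)
  have i: "i \<le> Suc n" unfolding i_def by (rule Least_le) (use assms in simp)
  have "i \<noteq> 0" using le assms by (intro notI) auto
  then obtain j where j: "i = Suc j" by (cases i) auto
  have "\<not> u \<le> grid a b n j"
    using not_less_Least[of j "\<lambda>i. u \<le> grid a b n i"] j by (auto simp: i_def)
  then show "\<exists>i. i \<le> n \<and> u \<in> {grid a b n i<..grid a b n (Suc i)}"
    using le i j by (intro exI[of _ j]) auto
  fix i j
  assume "i \<le> n \<and> u \<in> {grid a b n i<..grid a b n (Suc i)}"
    and "j \<le> n \<and> u \<in> {grid a b n j<..grid a b n (Suc j)}"
  then have "grid a b n i < grid a b n (Suc j)" "grid a b n j < grid a b n (Suc i)"
    by auto
  then have "\<not> Suc j \<le> i" "\<not> Suc i \<le> j"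
    using ab grid_mono[of a b "Suc j" i n] grid_mono[of a b "Suc i" j n] by auto
  then show "i = j" by simp
qed

lemma grid_cell_tendsto:
  assumes "\<And>n. u \<in> {grid a b n (i n)<..grid a b n (Suc (i n))}"
  shows "(\<lambda>n. grid a b n (i n)) \<longlonglongrightarrow> u" "(\<lambda>n. grid a b n (Suc (i n))) \<longlonglongrightarrow> u"
proof -
  have width: "grid a b n (Suc i) = grid a b n i + (b - a) / real (Suc n)" for n i
  proof -
    have "real (Suc i) = real i + 1" by simp
    then show ?thesis
      by (simp only: grid_def distrib_left add_divide_distrib mult_1_right add.assoc)
  qed
  have lim: "(\<lambda>n. (b - a) / real (Suc n)) \<longlonglongrightarrow> 0"
    by (intro LIMSEQ_Suc lim_const_over_n)
  show left: "(\<lambda>n. grid a b n (i n)) \<longlonglongrightarrow> u"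
  proof (rule tendsto_sandwich)
    show "(\<lambda>n. u - (b - a) / real (Suc n)) \<longlonglongrightarrow> u"
      using tendsto_diff[OF tendsto_const lim, of u] by simp
    show "\<forall>\<^sub>F n in sequentially. u - (b - a) / real (Suc n) \<le> grid a b n (i n)"
      using assms by (intro always_eventually allI) (auto simp only: width greaterThanAtMost_iff diff_le_eq)
    show "\<forall>\<^sub>F n in sequentially. grid a b n (i n) \<le> u"
      using assms by (intro always_eventually) (auto intro: less_imp_le)
  qed simp
  show "(\<lambda>n. grid a b n (Suc (i n))) \<longlonglongrightarrow> u"
    using tendsto_add[OF left lim] by (simp only: width add_0_right)
qed

text \<open>Dominated convergence for step functions: at \<open>u\<close> only the coefficient of
  the cell containing \<open>u\<close> is seen. The coefficients need not be values of a fixed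
  function, so the same statement serves for left end points, right end points and relative errors.
  Measurability of \<open>h\<close> is a conclusion, \<open>h\<close> being a limit of step
  functions on the interval.\<close>

lemma stieltjes_sum_limit:
  fixes c :: "nat \<Rightarrow> nat \<Rightarrow> real" and h :: "real \<Rightarrow> real"
  assumes F: "stieltjes F" and "a \<le> b"
    and bound: "\<And>n i. i \<le> n \<Longrightarrow> \<bar>c n i\<bar> \<le> B"
    and conv: "\<And>u i. \<lbrakk>u \<in> {a<..b}; \<And>n. i n \<le> n; \<And>n. u \<in> {grid a b n (i n)<..grid a b n (Suc (i n))}\<rbrakk>
      \<Longrightarrow> (\<lambda>n. c n (i n)) \<longlonglongrightarrow> h u"
  shows "set_integrable (interval_measure F) {a<..b} h" (is ?integrable)
    and "(\<lambda>n. \<Sum>i\<le>n. c n i * (F (grid a b n (Suc i)) - F (grid a b n i)))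
      \<longlonglongrightarrow> (LINT u:{a<..b}|interval_measure F. h u)" (is ?limit)
proof -
  let ?cell = "\<lambda>n i. {grid a b n i<..grid a b n (Suc i)}"
  define s where "s n u = (\<Sum>i\<le>n. c n i * indicator (?cell n i) u)" for n u
  let ?h = "\<lambda>u. indicator {a<..b} u *\<^sub>R h u"
  let ?w = "\<lambda>u. B * indicator {a<..b} u"
  have "0 \<le> B" using bound[of 0 0] by simp
  define i where "i u n = (THE i. i \<le> n \<and> u \<in> ?cell n i)" for u n
  have i: "i u n \<le> n" "u \<in> ?cell n (i u n)" if "u \<in> {a<..b}" for u n
    using theI'[OF grid_cell[OF that, of n]] by (auto simp: i_def)
  have s_in: "s n u = c n (i u n)" if u: "u \<in> {a<..b}" for n u
  proof -
    have "s n u = (\<Sum>j\<le>n. if j = i u n then c n j else 0)"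
      unfolding s_def
    proof (rule sum.cong[OF refl])
      fix j assume "j \<in> {..n}"
      then show "c n j * indicator (?cell n j) u = (if j = i u n then c n j else 0)"
        using i[OF u, of n] grid_cell[OF u, of n] by (auto simp: indicator_def)
    qed
    then show ?thesis using i(1)[OF u, of n] by simp
  qed
  have s_out: "s n u = 0" if "u \<notin> {a<..b}" for n u
    unfolding s_def
  proof (intro sum.neutral ballI)
    fix j assume "j \<in> {..n}"
    then have "u \<notin> ?cell n j"
      using that grid_bounds[OF \<open>a \<le> b\<close>, of j n] grid_bounds[OF \<open>a \<le> b\<close>, of "Suc j" n] by auto
    then show "c n j * indicator (?cell n j) u = 0" by simp
  qed
  have lim: "(\<lambda>n. s n u) \<longlonglongrightarrow> ?h u" for u
  proof (cases "u \<in> {a<..b}")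
    case True
    then show ?thesis using conv[OF True i[OF True]] by (simp add: s_in)
  qed (simp add: s_out)
  have meas_s: "s n \<in> borel_measurable (interval_measure F)" for n
    unfolding s_def by measurable
  have meas_h: "?h \<in> borel_measurable (interval_measure F)"
    by (rule borel_measurable_LIMSEQ_real[OF lim meas_s])
  have w: "integrable (interval_measure F) ?w"
    using set_integrable_const_Ioc[OF F, of a b B] by (simp add: set_integrable_def mult.commute)
  have le: "norm (s n u) \<le> ?w u" for n u
    using bound[of "i u n" n] i(1)[of u n] \<open>0 \<le> B\<close>
    by (cases "u \<in> {a<..b}") (simp_all add: s_in s_out)
  have dct: "integrable (interval_measure F) ?h"
    "(\<lambda>n. integral\<^sup>L (interval_measure F) (s n)) \<longlonglongrightarrow> integral\<^sup>L (interval_measure F) ?h"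
    by (rule integrable_dominated_convergence[OF meas_h meas_s w] integral_dominated_convergence[OF meas_h meas_s w],
      rule AE_I2, rule lim, rule AE_I2, rule le)+
  show ?integrable using dct(1) by (simp add: set_integrable_def)
  have "integral\<^sup>L (interval_measure F) (s n) =
      (\<Sum>i\<le>n. c n i * (F (grid a b n (Suc i)) - F (grid a b n i)))" for n
  proof -
    have le: "grid a b n i \<le> grid a b n (Suc i)" for i
      by (rule grid_mono[OF \<open>a \<le> b\<close>]) simp
    have "integrable (interval_measure F) (\<lambda>u. c n i * indicator (?cell n i) u)" for i
      using set_integrable_const_Ioc[OF F, of "grid a b n i" "grid a b n (Suc i)" "c n i"]
      by (simp add: set_integrable_def mult.commute)
    then have "integral\<^sup>L (interval_measure F) (s n) =
        (\<Sum>i\<le>n. integral\<^sup>L (interval_measure F) (\<lambda>u. c n i * indicator (?cell n i) u))"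
      unfolding s_def by (rule Bochner_Integration.integral_sum)
    then show ?thesis by (simp add: measure_stieltjes_Ioc[OF F le])
  qed
  with dct(2) show ?limit by (simp add: set_lebesgue_integral_def)
qed

lemma set_integral_near_const:
  fixes f :: "real \<Rightarrow> real"
  assumes F: "stieltjes F" and "a \<le> b"
    and int: "set_integrable (interval_measure F) {a<..b} f"
    and near: "\<And>u. u \<in> {a<..b} \<Longrightarrow> \<bar>f u - c\<bar> \<le> e"
  shows "\<bar>(LINT u:{a<..b}|interval_measure F. f u) - c * (F b - F a)\<bar> \<le> e * (F b - F a)"
proof -
  note const = set_integrable_const_Ioc[OF F] set_integral_const_Ioc[OF F \<open>a \<le> b\<close>]
  have "(LINT u:{a<..b}|interval_measure F. f u) \<le> (LINT u:{a<..b}|interval_measure F. c + e)"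
    using near by (intro set_integral_mono int const) force
  moreover have "(LINT u:{a<..b}|interval_measure F. c - e) \<le> (LINT u:{a<..b}|interval_measure F. f u)"
    using near by (intro set_integral_mono int const) force
  ultimately show ?thesis by (simp add: const algebra_simps abs_le_iff)
qed

section \<open>The damping factor as a product integral\<close>

context damping_path
begin

lemma damp_grid_prod:
  assumes "a \<le> b" "m \<le> n"
  shows "(\<Prod>i\<le>m. damp z (grid a b n i) (grid a b n (Suc i))) = damp z a (grid a b n (Suc m))"
  using \<open>m \<le> n\<close>
proof (induction m)
  case (Suc m)
  then show ?case
    using damp_mult[of a "grid a b n (Suc m)" "grid a b n (Suc (Suc m))"]
      grid_bounds[OF assms(1), of "Suc m" n] grid_mono[OF assms(1), of "Suc m" "Suc (Suc m)" n]
    by simp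
qed simp

lemma increment_tendsto_jump:
  assumes "\<And>n. u \<in> {l n<..r n}" "l \<longlonglongrightarrow> u" "r \<longlonglongrightarrow> u"
  shows "(\<lambda>n. z (r n) - z (l n)) \<longlonglongrightarrow> jump z u"
  unfolding jump_def
proof (rule tendsto_diff)
  have lr: "l n < u" "u \<le> r n" for n using assms(1)[of n] by auto
  show "(\<lambda>n. z (r n)) \<longlonglongrightarrow> z u"
    by (rule right_continuous_sequence[OF stieltjesD(3)[OF stieltjes] assms(3) lr(2)])
  show "(\<lambda>n. z (l n)) \<longlonglongrightarrow> Lim (at_left u) z"
    by (rule left_limit_sequence[OF left_limit_mono[OF mono_z] assms(2) lr(1)])
qed

text \<open>
  The product formula expresses the damping factor through increments of \<open>z\<close>, so that
  measurability and shift equivariance are read off without looking at individual jumps.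
\<close>

lemma damp_prod_limit:
  assumes "a \<le> b"
  shows "(\<lambda>n. \<Prod>i\<le>n. max 0 (1 - (z (grid a b n (Suc i)) - z (grid a b n i)))) \<longlonglongrightarrow> damp z a b"
proof -
  define d where "d n i = z (grid a b n (Suc i)) - z (grid a b n i)" for n i
  define e where "e n i = damp z (grid a b n i) (grid a b n (Suc i))" for n i
  \<comment> \<open>Every jump is at most \<open>1\<close>, but the increment over a cell can exceed
    \<open>1\<close>; the truncation keeps the factor in \<open>[0,1]\<close>.\<close>
  define p where "p n i = max 0 (1 - d n i)" for n i
  \<comment> \<open>The error of one factor relative to the increment of \<open>z\<close>. The total
    error becomes a Stieltjes sum with coefficients \<open>c\<close>, which vanishes in the limit
    once \<open>c\<close> tends to \<open>0\<close> along the cells around each \<open>u\<close>.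
    For \<open>d n i = 0\<close> the quotient is \<open>0\<close>, and so is the error.\<close>
  define c where "c n i = (e n i - p n i) / d n i" for n i
  have step: "grid a b n i \<le> grid a b n (Suc i)" for n i
    by (rule grid_mono[OF assms]) simp
  have d: "0 \<le> d n i" for n i using z_le[OF step] by (simp add: d_def)
  have e: "0 \<le> e n i" "e n i \<le> 1" "1 - d n i \<le> e n i" "e n i \<le> 1 - d n i + (d n i)\<^sup>2" for n i
    using damp_nonneg damp_le_1[OF step] damp_lower[OF step] damp_upper[OF step]
    by (simp_all add: e_def d_def)
  have pe: "p n i \<le> e n i" "e n i - p n i \<le> (d n i)\<^sup>2" for n i
    using e[of n i] by (auto simp: p_def)
  have c0: "0 \<le> c n i" and cd: "c n i \<le> d n i" for n i
  proof -
    show "0 \<le> c n i" using pe[of n i] d[of n i] by (simp add: c_def)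
    show "c n i \<le> d n i"
      using pe[of n i] d[of n i] by (cases "d n i = 0") (simp_all add: c_def field_simps power2_eq_square)
  qed
  have c1: "c n i \<le> 1" for n i
  proof (cases "d n i = 0")
    case False
    then have "0 < d n i" using d[of n i] by simp
    moreover have "e n i - p n i \<le> d n i" using e[of n i] by (auto simp: p_def)
    ultimately show ?thesis by (simp add: c_def field_simps)
  qed (simp add: c_def)
  \<comment> \<open>At a jump of \<open>z\<close> the bound \<open>cd\<close> tends only to the jump
    size. Here the numerator is the increment of \<open>z\<close> apart from the jump, which does
    tend to \<open>0\<close>.\<close>
  have cj: "c n i \<le> (d n i - jump z u) / d n i" if "u \<in> {grid a b n i<..grid a b n (Suc i)}" for u n i
  proof -
    have "e n i - p n i \<le> d n i - jump z u"
      using damp_le_1_minus_jump[OF that] by (auto simp: p_def e_def)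
    then show ?thesis using d[of n i] by (simp add: c_def divide_right_mono)
  qed
  have "(\<lambda>n. \<Sum>i\<le>n. c n i * (z (grid a b n (Suc i)) - z (grid a b n i)))
      \<longlonglongrightarrow> (LINT u:{a<..b}|interval_measure z. 0)"
  proof (rule stieltjes_sum_limit(2)[OF stieltjes assms, where B = 1])
    show "\<bar>c n i\<bar> \<le> 1" for n i using c0 c1 by simp
    fix u and i :: "nat \<Rightarrow> nat"
    assume cell: "\<And>n. u \<in> {grid a b n (i n)<..grid a b n (Suc (i n))}"
    have lim: "(\<lambda>n. d n (i n)) \<longlonglongrightarrow> jump z u"
      unfolding d_def by (rule increment_tendsto_jump[OF cell grid_cell_tendsto[OF cell]])
    show "(\<lambda>n. c n (i n)) \<longlonglongrightarrow> 0"
    proof (cases "jump z u = 0")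
      case True
      show ?thesis
        by (rule tendsto_sandwich[OF always_eventually always_eventually tendsto_const])
          (use c0 cd lim True in auto)
    next
      case False
      have "(\<lambda>n. (d n (i n) - jump z u) / d n (i n)) \<longlonglongrightarrow> (jump z u - jump z u) / jump z u"
        by (intro tendsto_intros lim False)
      then have lim': "(\<lambda>n. (d n (i n) - jump z u) / d n (i n)) \<longlonglongrightarrow> 0" by simp
      show ?thesis
        by (rule tendsto_sandwich[OF always_eventually always_eventually tendsto_const lim'])
          (intro allI c0 cj[OF cell])+
    qed
  qed
  moreover have "c n i * (z (grid a b n (Suc i)) - z (grid a b n i)) = e n i - p n i" for n i
    using pe[of n i] by (auto simp: c_def d_def[symmetric])
  ultimately have lim: "(\<lambda>n. \<Sum>i\<le>n. e n i - p n i) \<longlonglongrightarrow> 0" by simp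
  have "(\<lambda>n. (\<Prod>i\<le>n. e n i) - (\<Prod>i\<le>n. p n i)) \<longlonglongrightarrow> 0"
  proof (rule Lim_null_comparison[OF always_eventually lim], rule allI)
    fix n
    \<comment> \<open>All factors lie in \<open>[0,1]\<close>, so the difference of the products is
      at most the sum of the differences.\<close>
    have "norm ((\<Prod>i\<le>n. e n i) - (\<Prod>i\<le>n. p n i)) \<le> (\<Sum>i\<le>n. norm (e n i - p n i))"
      using e d by (intro norm_prod_diff) (auto simp: p_def)
    also have "\<dots> = (\<Sum>i\<le>n. e n i - p n i)"
      using pe by (intro sum.cong) auto
    finally show "norm ((\<Prod>i\<le>n. e n i) - (\<Prod>i\<le>n. p n i)) \<le> (\<Sum>i\<le>n. e n i - p n i)" .
  qed
  moreover have "(\<Prod>i\<le>n. e n i) = damp z a b" for n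
    using damp_grid_prod[OF assms, of n n] by (simp add: e_def)
  ultimately have "(\<lambda>n. damp z a b - (damp z a b - (\<Prod>i\<le>n. p n i))) \<longlonglongrightarrow> damp z a b - 0"
    by (intro tendsto_diff tendsto_const) simp
  then show ?thesis by (simp add: p_def d_def)
qed

end

section \<open>The flow\<close>

definition inflow :: "(real \<Rightarrow> real) \<Rightarrow> (real \<Rightarrow> real) \<Rightarrow> real \<Rightarrow> real \<Rightarrow> real" where
  "inflow y z a b = (LINT s:{a<..b}|interval_measure y. damp z s b)"

locale flow_path = damping_path z for z :: "real \<Rightarrow> real" +
  fixes y :: "real \<Rightarrow> real"
  assumes stieltjes_y: "stieltjes y"
begin

lemmas mono_y = stieltjesD(1)[OF stieltjes_y]
  and y_le = stieltjesD(2)[OF stieltjes_y]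

lemma damp_integrable: "set_integrable (interval_measure y) {a<..b} (\<lambda>s. damp z s c)" if "b \<le> c"
  by (rule set_integrable_bounded_Ioc[OF stieltjes_y, where B = 1])
    (use that damp_nonneg damp_le_1 in \<open>auto intro: order_trans\<close>)

lemma inflow_refl [simp]: "inflow y z a a = 0"
  by (simp add: inflow_def set_lebesgue_integral_def)

lemma inflow_nonneg: "0 \<le> inflow y z a b"
  unfolding inflow_def set_lebesgue_integral_def
  by (rule Bochner_Integration.integral_nonneg) (auto simp: damp_nonneg)

lemma inflow_le: "a \<le> b \<Longrightarrow> inflow y z a b \<le> y b - y a"
  using set_integral_mono[OF damp_integrable set_integrable_const_Ioc[OF stieltjes_y], of b b a 1]
  by (simp add: inflow_def set_integral_const_Ioc[OF stieltjes_y] damp_le_1)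

text \<open>By multiplicativity the part of the integral up to \<open>b\<close> is damped over
  \<open>(b,c]\<close> by a factor that does not depend on \<open>s\<close>.\<close>

lemma inflow_flow:
  assumes "a \<le> b" "b \<le> c"
  shows "inflow y z a c = damp z b c * inflow y z a b + inflow y z b c"
proof -
  have "inflow y z a c =
      (LINT s:{a<..b}|interval_measure y. damp z s c) + inflow y z b c"
    unfolding inflow_def by (rule set_integral_split_Ioc[OF damp_integrable assms]) simp
  moreover have "(LINT s:{a<..b}|interval_measure y. damp z s c) =
      (LINT s:{a<..b}|interval_measure y. damp z b c * damp z s b)"
  proof (rule set_lebesgue_integral_cong)
    show "\<forall>s. s \<in> {a<..b} \<longrightarrow> damp z s c = damp z b c * damp z s b"
    proof (intro allI impI)
      fix s assume "s \<in> {a<..b}"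
      then have "s \<le> b" by simp
      from damp_mult[OF this assms(2)] show "damp z s c = damp z b c * damp z s b"
        by (simp only: mult.commute)
    qed
  qed simp
  ultimately show ?thesis by (simp add: inflow_def)
qed

text \<open>An earlier start only adds the nonnegative mass that entered before \<open>b\<close>.
  The stochastic order and the monotone approach to \<open>X_star\<close> both come from
  here.\<close>

lemma inflow_antimono: "a \<le> b \<Longrightarrow> b \<le> c \<Longrightarrow> inflow y z b c \<le> inflow y z a c"
  using inflow_flow[of a b c] damp_nonneg[of b c] inflow_nonneg[of a b] by simp

lemma inflow_ge: "a \<le> b \<Longrightarrow> damp z a b * (y b - y a) \<le> inflow y z a b"
  using set_integral_mono[OF set_integrable_const_Ioc[OF stieltjes_y] damp_integrable, of b b a "damp z a b"]
  by (simp add: inflow_def set_integral_const_Ioc[OF stieltjes_y] damp_mono_left)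

text \<open>Right end points are the correct choice: moving the start from \<open>u\<close> to
  \<open>r \<ge> u\<close> changes \<open>damp z u b\<close> by at most \<open>z r - z u\<close>, so
  the factor is right-continuous in its start. Together with the product formula this expresses
  \<open>inflow\<close> through increments of both paths.\<close>

lemma inflow_sum_limit:
  assumes "a \<le> b"
  shows "(\<lambda>n. \<Sum>i\<le>n. damp z (grid a b n (Suc i)) b * (y (grid a b n (Suc i)) - y (grid a b n i)))
    \<longlonglongrightarrow> inflow y z a b"
  unfolding inflow_def
proof (rule stieltjes_sum_limit(2)[OF stieltjes_y assms, where B = 1])
  show "\<bar>damp z (grid a b n (Suc i)) b\<bar> \<le> 1" if "i \<le> n" for n i
    using grid_bounds[OF assms, of "Suc i" n] that by (simp add: damp_nonneg damp_le_1)
  fix u and i :: "nat \<Rightarrow> nat"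
  assume i: "\<And>n. i n \<le> n" and cell: "\<And>n. u \<in> {grid a b n (i n)<..grid a b n (Suc (i n))}"
  define r where "r n = grid a b n (Suc (i n))" for n
  have r: "u \<le> r n" "r n \<le> b" for n
    using cell[of n] grid_bounds(2)[OF assms, of "Suc (i n)" n] i[of n] by (auto simp: r_def)
  have "r \<longlonglongrightarrow> u"
    using grid_cell_tendsto(2)[OF cell] by (simp add: r_def[abs_def])
  from tendsto_diff[OF right_continuous_sequence[OF stieltjesD(3)[OF stieltjes] this r(1)] tendsto_const]
  have "(\<lambda>n. z (r n) - z u) \<longlonglongrightarrow> z u - z u" .
  then have lim: "(\<lambda>n. z (r n) - z u) \<longlonglongrightarrow> 0" by simp
  have "(\<lambda>n. damp z (r n) b - damp z u b) \<longlonglongrightarrow> 0"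
  proof (rule Lim_null_comparison[OF always_eventually lim], rule allI)
    fix n
    have "damp z (r n) b - damp z u b = (1 - damp z u (r n)) * damp z (r n) b"
      using damp_mult[OF r, of n] by (simp add: algebra_simps)
    also have "\<dots> \<le> (z (r n) - z u) * 1"
      using damp_lower[OF r(1), of n] damp_le_1[OF r(2), of n] damp_nonneg[of "r n" b] z_le[OF r(1), of n]
      by (intro mult_mono) auto
    finally show "norm (damp z (r n) b - damp z u b) \<le> z (r n) - z u"
      using damp_mono_left[OF r, of n] by simp
  qed
  then have "(\<lambda>n. (damp z (r n) b - damp z u b) + damp z u b) \<longlonglongrightarrow> 0 + damp z u b"
    by (intro tendsto_intros)
  then show "(\<lambda>n. damp z (grid a b n (Suc (i n))) b) \<longlonglongrightarrow> damp z u b"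
    by (simp add: r_def)
qed

text \<open>A jump of \<open>y\<close> at the right end point enters undamped: it is in the last cell of every grid.\<close>

lemma inflow_ge_jump:
  assumes "a < b"
  shows "jump y b \<le> inflow y z a b"
proof (rule LIMSEQ_le[OF _ inflow_sum_limit])
  have less: "grid a b n n < b" for n
    using assms by (simp add: grid_def field_simps)
  have "b \<in> {grid a b n n<..grid a b n (Suc n)}" for n
    using less by simp
  from grid_cell_tendsto(1)[of b a b "\<lambda>n. n", OF this]
  show "(\<lambda>n. y b - y (grid a b n n)) \<longlonglongrightarrow> jump y b"
    unfolding jump_def using less
    by (intro tendsto_diff tendsto_const left_limit_sequence[OF left_limit_mono[OF mono_y]])
  have "y b - y (grid a b n n) \<le> (\<Sum>i\<le>n. damp z (grid a b n (Suc i)) b * (y (grid a b n (Suc i)) - y (grid a b n i)))" for n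
  proof -
    have "(\<Sum>i\<in>{n}. damp z (grid a b n (Suc i)) b * (y (grid a b n (Suc i)) - y (grid a b n i)))
        \<le> (\<Sum>i\<le>n. damp z (grid a b n (Suc i)) b * (y (grid a b n (Suc i)) - y (grid a b n i)))"
      using assms by (intro sum_mono2) (auto simp: damp_nonneg intro!: mult_nonneg_nonneg y_le grid_mono)
    then show ?thesis by simp
  qed
  then show "\<exists>N. \<forall>n\<ge>N. y b - y (grid a b n n) \<le> (\<Sum>i\<le>n. damp z (grid a b n (Suc i)) b * (y (grid a b n (Suc i)) - y (grid a b n i)))"
    by blast
qed (use assms in simp)

end

section \<open>Pathwise solutions\<close>

lemma cadlag_nonneg_right: "cadlag_nonneg x \<Longrightarrow> 0 \<le> t \<Longrightarrow> (x \<longlongrightarrow> x t) (at_right t)"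
  by (simp add: cadlag_nonneg_def continuous_within)

lemma cadlag_nonneg_left:
  assumes "cadlag_nonneg x" "0 < t"
  shows "(x \<longlongrightarrow> Lim (at_left t) x) (at_left t)"
proof -
  obtain l where "(x \<longlongrightarrow> l) (at_left t)" using assms by (auto simp: cadlag_nonneg_def)
  then show ?thesis by (simp add: tendsto_Lim)
qed

lemma cadlag_nonneg_left_bound:
  assumes "cadlag_nonneg x" "0 \<le> a" "u \<in> {a<..b}" and near: "\<And>s. a < s \<Longrightarrow> s < b \<Longrightarrow> \<bar>x s - c\<bar> \<le> e"
  shows "\<bar>Lim (at_left u) x - c\<bar> \<le> e"
proof (rule tendsto_upperbound)
  show "((\<lambda>s. \<bar>x s - c\<bar>) \<longlongrightarrow> \<bar>Lim (at_left u) x - c\<bar>) (at_left u)"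
    using assms by (intro tendsto_intros cadlag_nonneg_left) auto
  show "\<forall>\<^sub>F s in at_left u. \<bar>x s - c\<bar> \<le> e"
    unfolding eventually_at_left_field using assms by (intro exI[of _ a]) auto
qed simp

text \<open>Continuous induction on the end point: right continuity extends a bound past
  \<open>t\<close>, while the left limit and the single value at \<open>t\<close> extend bounds
  before \<open>t\<close> up to \<open>t\<close>.\<close>

lemma cadlag_nonneg_bounded:
  assumes x: "cadlag_nonneg x" and "0 \<le> t"
  shows "\<exists>B. \<forall>s. 0 \<le> s \<and> s \<le> t \<longrightarrow> \<bar>x s\<bar> \<le> B"
  using \<open>0 \<le> t\<close>
proof (induction rule: real_induct_ge)
  case (right t)
  then obtain B where B: "\<And>s. 0 \<le> s \<Longrightarrow> s \<le> t \<Longrightarrow> \<bar>x s\<bar> \<le> B" by blast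
  have "\<forall>\<^sub>F s in at_right t. \<bar>x s\<bar> < \<bar>x t\<bar> + 1"
    by (rule order_tendstoD(2)[OF tendsto_rabs[OF cadlag_nonneg_right[OF x right(1)]]]) simp
  then obtain d where "d > t" and d: "\<And>s. t < s \<Longrightarrow> s < d \<Longrightarrow> \<bar>x s\<bar> < \<bar>x t\<bar> + 1"
    by (auto simp: eventually_at_right_field)
  have "\<bar>x r\<bar> \<le> max B (\<bar>x t\<bar> + 1)" if "0 \<le> r" "r < d" for r
    using B[of r] d[of r] that by (cases "r \<le> t") auto
  then show ?case
    unfolding eventually_at_right_field using \<open>d > t\<close>
    by (intro exI[of _ d] conjI allI impI exI[of _ "max B (\<bar>x t\<bar> + 1)"]) auto
next
  case (left t)
  show ?case
  proof (cases "t = 0")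
    case False
    then have "0 < t" using left by simp
    obtain l where l: "(x \<longlongrightarrow> l) (at_left t)" using x \<open>0 < t\<close> by (auto simp: cadlag_nonneg_def)
    have "\<forall>\<^sub>F s in at_left t. \<bar>x s\<bar> < \<bar>l\<bar> + 1"
      by (rule order_tendstoD(2)[OF tendsto_rabs[OF l]]) simp
    then obtain d where "d < t" and d: "\<And>s. d < s \<Longrightarrow> s < t \<Longrightarrow> \<bar>x s\<bar> < \<bar>l\<bar> + 1"
      by (auto simp: eventually_at_left_field)
    obtain B where B: "\<And>s. 0 \<le> s \<Longrightarrow> s \<le> max 0 d \<Longrightarrow> \<bar>x s\<bar> \<le> B"
      using left(2)[of "max 0 d"] \<open>d < t\<close> \<open>0 < t\<close> by auto
    have "\<bar>x r\<bar> \<le> max \<bar>x t\<bar> (max B (\<bar>l\<bar> + 1))" if "0 \<le> r" "r \<le> t" for r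
      using B[of r] d[of r] that by (cases "r = t"; cases "r \<le> max 0 d") (auto simp: le_max_iff_disj)
    then show ?thesis by blast
  qed (auto intro!: exI[of _ "\<bar>x 0\<bar>"])
qed

text \<open>The point is measurability of the left-limit function on the interval, as
  \<open>x\<close> is not assumed to be Borel. Sampling \<open>x\<close> at left grid points
  exhibits the function as a bounded pointwise limit of step functions.\<close>

lemma cadlag_nonneg_left_integrable:
  assumes "stieltjes z" and x: "cadlag_nonneg x" and "0 \<le> a"
  shows "set_integrable (interval_measure z) {a<..b} (\<lambda>s. Lim (at_left s) x)"
proof (cases "a \<le> b")
  case True
  obtain B where B: "\<And>s. 0 \<le> s \<Longrightarrow> s \<le> b \<Longrightarrow> \<bar>x s\<bar> \<le> B"
    using cadlag_nonneg_bounded[OF x, of b] assms True by auto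
  show ?thesis
  proof (rule stieltjes_sum_limit(1)[OF assms(1) True, where c = "\<lambda>n i. x (grid a b n i)"])
    show "\<bar>x (grid a b n i)\<bar> \<le> B" if "i \<le> n" for n i
      using B grid_bounds[OF True, of i n] that \<open>0 \<le> a\<close> by simp
    fix u and i :: "nat \<Rightarrow> nat"
    assume u: "u \<in> {a<..b}" and cell: "\<And>n. u \<in> {grid a b n (i n)<..grid a b n (Suc (i n))}"
    show "(\<lambda>n. x (grid a b n (i n))) \<longlonglongrightarrow> Lim (at_left u) x"
    proof (rule left_limit_sequence[OF cadlag_nonneg_left[OF x] grid_cell_tendsto(1)[OF cell]])
      show "grid a b n (i n) < u" for n using cell[of n] by simp
    qed (use u \<open>0 \<le> a\<close> in auto)
  qed
qed (simp add: set_integrable_def)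

lemma cadlag_nonneg_left_near_const:
  assumes "stieltjes z" "cadlag_nonneg x" "0 \<le> a" "a \<le> b"
    and "\<And>s. a < s \<Longrightarrow> s < b \<Longrightarrow> \<bar>x s - c\<bar> \<le> e"
  shows "\<bar>(LINT u:{a<..b}|interval_measure z. Lim (at_left u) x) - c * (z b - z a)\<bar> \<le> e * (z b - z a)"
  using cadlag_nonneg_left_integrable[OF assms(1-3)] cadlag_nonneg_left_bound[OF assms(2,3) _ assms(5)]
  by (rule set_integral_near_const[OF assms(1,4)])

text \<open>The difference \<open>d\<close> solves the homogeneous equation. Just after a zero time
  the integral operator is a contraction, because \<open>z\<close> has grown by less than
  \<open>1/2\<close>; continuous induction then spreads \<open>d = 0\<close> over the
  half-line.\<close>

lemma solution_unique:
  assumes z: "stieltjes z" and x: "cadlag_nonneg x" and x': "cadlag_nonneg x'"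
    and eq: "\<And>t. 0 \<le> t \<Longrightarrow> x t = k t - (LINT s:{0<..t}|interval_measure z. Lim (at_left s) x)"
    and eq': "\<And>t. 0 \<le> t \<Longrightarrow> x' t = k t - (LINT s:{0<..t}|interval_measure z. Lim (at_left s) x')"
    and "0 \<le> t"
  shows "x t = x' t"
proof -
  define d where "d t = x t - x' t" for t
  define I where "I a b = (LINT s:{a<..b}|interval_measure z. Lim (at_left s) d)" for a b
  have lim: "Lim (at_left s) d = Lim (at_left s) x - Lim (at_left s) x'" if "0 < s" for s
    using tendsto_diff[OF cadlag_nonneg_left[OF x that] cadlag_nonneg_left[OF x' that]]
    by (intro tendsto_Lim) (simp_all add: d_def[abs_def])
  have d: "cadlag_nonneg d"
    using x x' unfolding cadlag_nonneg_def d_def[abs_def]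
    by (blast intro: tendsto_diff continuous_diff)
  have d_eq: "d t = - I 0 t" if "0 \<le> t" for t
  proof -
    have "I 0 t = (LINT s:{0<..t}|interval_measure z. Lim (at_left s) x - Lim (at_left s) x')"
      unfolding I_def by (rule set_lebesgue_integral_cong) (auto simp: lim)
    then show ?thesis
      using eq[OF that] eq'[OF that] cadlag_nonneg_left_integrable[OF z x] cadlag_nonneg_left_integrable[OF z x']
      by (simp add: set_integral_diff d_def)
  qed
  have I_le: "\<bar>I a b\<bar> \<le> e * (z b - z a)" if "0 \<le> a" "a \<le> b" "\<And>s. a < s \<Longrightarrow> s < b \<Longrightarrow> \<bar>d s\<bar> \<le> e" for a b e
    using cadlag_nonneg_left_near_const[OF z d that(1,2), of 0 e] that(3) by (simp add: I_def)
  have "d t = 0"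
    using \<open>0 \<le> t\<close>
  proof (induction rule: real_induct_ge)
    case (right t)
    have "\<forall>\<^sub>F s in at_right t. \<bar>d s\<bar> < 1"
      using order_tendstoD(2)[OF tendsto_rabs[OF cadlag_nonneg_right[OF d right(1)]], of 1] right by simp
    \<comment> \<open>Any jump of \<open>z\<close> at \<open>t\<close> lies outside
      \<open>(t,s]\<close>, so the contraction constant \<open>1/2\<close> is available whatever its
      size.\<close>
    moreover have "\<forall>\<^sub>F s in at_right t. z s < z t + 1/2"
      by (rule order_tendstoD(2)[OF stieltjesD(4)[OF z]]) simp
    ultimately have "\<forall>\<^sub>F s in at_right t. \<bar>d s\<bar> < 1 \<and> z s < z t + 1/2"
      by (rule eventually_conj)
    then obtain b where "b > t" and b: "\<And>s. t < s \<Longrightarrow> s < b \<Longrightarrow> \<bar>d s\<bar> < 1 \<and> z s < z t + 1/2"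
      by (auto simp: eventually_at_right_field)
    have small: "\<bar>d s\<bar> \<le> (1/2) ^ k" if "t < s" "s < b" for s k
      using that
    proof (induction k arbitrary: s)
      case 0
      then show ?case using b[of s] by simp
    next
      case (Suc k)
      have "\<bar>I t s\<bar> \<le> (1/2) ^ k * (z s - z t)"
        using Suc right(1) by (intro I_le) auto
      also have "\<dots> \<le> (1/2) ^ k * (1/2)"
        using b[of s] Suc.prems by (intro mult_left_mono) auto
      finally have "\<bar>I t s\<bar> \<le> (1/2) ^ Suc k" by simp
      moreover have "I 0 s = I 0 t + I t s"
        unfolding I_def using cadlag_nonneg_left_integrable[OF z d] right(1) Suc.prems
        by (intro set_integral_split_Ioc) auto
      ultimately show ?case using d_eq[of s] d_eq[of t] right Suc.prems by simp
    qed
    have "d s = 0" if "t < s" "s < b" for s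
    proof -
      have "(\<lambda>k. (1/2 :: real) ^ k) \<longlonglongrightarrow> 0" by (rule LIMSEQ_realpow_zero) auto
      from LIMSEQ_le_const[OF this, of "\<bar>d s\<bar>"] small[OF that] show ?thesis by auto
    qed
    then show ?case using \<open>b > t\<close> by (auto simp: eventually_at_right_field)
  next
    case (left t)
    \<comment> \<open>The integrand on \<open>(0,t]\<close> uses only values of \<open>d\<close>
      strictly before \<open>t\<close>, so the bound \<open>e = 0\<close> applies even if
      \<open>z\<close> jumps at \<open>t\<close>.\<close>
    have "\<bar>I 0 t\<bar> \<le> 0 * (z t - z 0)"
      by (rule I_le) (use left in auto)
    then show ?case using d_eq[OF left(1)] by simp
  qed
  then show ?thesis by (simp add: d_def)
qed

section \<open>Jumps of the flow, and the flow as a solution\<close>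

lemma (in damping_path) damp_left_limit:
  "((\<lambda>s. damp z s t) \<longlongrightarrow> 1 - jump z t) (at_left t)"
proof (rule tendsto_sandwich)
  show "((\<lambda>s. 1 - (z t - z s)) \<longlongrightarrow> 1 - jump z t) (at_left t)"
    unfolding jump_def by (intro tendsto_diff tendsto_const left_limit_mono[OF mono_z])
  show "\<forall>\<^sub>F s in at_left t. 1 - (z t - z s) \<le> damp z s t"
    unfolding eventually_at_left_field by (intro exI[of _ "t - 1"]) (auto simp: damp_lower)
  show "\<forall>\<^sub>F s in at_left t. damp z s t \<le> 1 - jump z t"
    unfolding eventually_at_left_field by (intro exI[of _ "t - 1"]) (auto simp: damp_le_1_minus_jump)
qed simp

context flow_path
begin

lemma inflow_left_limit: "((\<lambda>s. inflow y z s t) \<longlongrightarrow> jump y t) (at_left t)"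
proof (rule tendsto_sandwich[OF _ _ tendsto_const])
  show "((\<lambda>s. y t - y s) \<longlongrightarrow> jump y t) (at_left t)"
    unfolding jump_def by (intro tendsto_diff tendsto_const left_limit_mono[OF mono_y])
  show "\<forall>\<^sub>F s in at_left t. inflow y z s t \<le> y t - y s"
    unfolding eventually_at_left_field by (intro exI[of _ "t - 1"]) (auto simp: inflow_le)
  show "\<forall>\<^sub>F s in at_left t. jump y t \<le> inflow y z s t"
    unfolding eventually_at_left_field by (intro exI[of _ "t - 1"]) (auto simp: inflow_ge_jump)
qed

text \<open>Stated between any two nonnegative times, as regularity and the equation are local.
  Solutions started at \<open>0\<close> and the stationary solution, whose inflow comes from the
  whole past, are both instances.\<close>

definition is_flow :: "(real \<Rightarrow> real) \<Rightarrow> bool" where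
  "is_flow x \<longleftrightarrow> (\<forall>a b. 0 \<le> a \<longrightarrow> a \<le> b \<longrightarrow> x b = damp z a b * x a + inflow y z a b)"

lemma is_flow_start:
  "is_flow (\<lambda>t. damp z 0 t * k + inflow y z 0 t)"
  unfolding is_flow_def
proof (intro allI impI)
  fix a b :: real assume ab: "0 \<le> a" "a \<le> b"
  show "damp z 0 b * k + inflow y z 0 b = damp z a b * (damp z 0 a * k + inflow y z 0 a) + inflow y z a b"
    unfolding damp_mult[OF ab] inflow_flow[OF ab] by (simp add: algebra_simps)
qed

lemma is_flowD: "is_flow x \<Longrightarrow> 0 \<le> a \<Longrightarrow> a \<le> b \<Longrightarrow> x b = damp z a b * x a + inflow y z a b"
  unfolding is_flow_def by blast

text \<open>Right continuity follows from bounding the change of \<open>x\<close> by the increments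
  of \<open>z\<close> and \<open>y\<close>. Left limits exist because \<open>x\<close> is composed
  of monotone functions: \<open>damp z 0\<close> is nonincreasing, and \<open>y\<close> minus the
  inflow is nondecreasing, as no more can be present than has entered.\<close>

lemma flow_cadlag:
  assumes x: "is_flow x"
  shows "cadlag_nonneg x"
  unfolding cadlag_nonneg_def continuous_within
proof (intro conjI allI impI)
  fix t :: real assume "0 \<le> t"
  have "((\<lambda>s. x s - x t) \<longlongrightarrow> 0) (at_right t)"
  proof (rule Lim_null_comparison)
    show "\<forall>\<^sub>F s in at_right t. norm (x s - x t) \<le> (z s - z t) * \<bar>x t\<bar> + (y s - y t)"
      unfolding eventually_at_right_field
    proof (intro exI[of _ "t + 1"] conjI allI impI)
      fix s assume "t < s"
      then have "x s - x t = (damp z t s - 1) * x t + inflow y z t s"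
        using is_flowD[OF x \<open>0 \<le> t\<close>, of s] by (simp add: algebra_simps)
      then have "\<bar>x s - x t\<bar> \<le> \<bar>damp z t s - 1\<bar> * \<bar>x t\<bar> + \<bar>inflow y z t s\<bar>"
        using abs_triangle_ineq by (simp add: abs_mult[symmetric])
      also have "\<dots> \<le> (z s - z t) * \<bar>x t\<bar> + (y s - y t)"
        using damp_lower[of t s] damp_le_1[of t s] inflow_le[of t s] inflow_nonneg[of t s] \<open>t < s\<close>
        by (intro add_mono mult_right_mono) auto
      finally show "norm (x s - x t) \<le> (z s - z t) * \<bar>x t\<bar> + (y s - y t)" by simp
    qed simp
    have "((\<lambda>s. (z s - z t) * \<bar>x t\<bar> + (y s - y t)) \<longlongrightarrow> (z t - z t) * \<bar>x t\<bar> + (y t - y t)) (at_right t)"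
      by (intro tendsto_intros stieltjesD(4) stieltjes stieltjes_y)
    then show "((\<lambda>s. (z s - z t) * \<bar>x t\<bar> + (y s - y t)) \<longlongrightarrow> 0) (at_right t)" by simp
  qed
  then show "(x \<longlongrightarrow> x t) (at_right t)" by (simp add: LIM_zero_iff)
next
  fix t :: real assume "0 < t"
  \<comment> \<open>The truncation \<open>max 0 s\<close> makes \<open>f\<close> and
    \<open>g\<close> monotone on the whole line, as required for left limits, without changing them
    at positive times.\<close>
  define f where "f s = - damp z 0 (max 0 s)" for s
  define g where "g s = y (max 0 s) - inflow y z 0 (max 0 s)" for s
  have "mono f"
    by (intro monoI) (auto simp: f_def intro!: damp_antimono_right max.mono)
  have "g a \<le> g b" if "a \<le> b" for a b
  proof -
    have "inflow y z 0 (max 0 b) \<le> 1 * inflow y z 0 (max 0 a) + (y (max 0 b) - y (max 0 a))"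
      using that unfolding inflow_flow[of 0 "max 0 a" "max 0 b", OF max.cobounded1 max.mono[OF order_refl that]]
      by (intro add_mono mult_right_mono damp_le_1 inflow_le inflow_nonneg) auto
    then show ?thesis by (simp add: g_def)
  qed
  then have "mono g" by (rule monoI)
  have "((\<lambda>s. (- f s) * x 0 + (y s - g s)) \<longlongrightarrow>
      (- Lim (at_left t) f) * x 0 + (Lim (at_left t) y - Lim (at_left t) g)) (at_left t)"
    by (intro tendsto_intros left_limit_mono \<open>mono f\<close> \<open>mono g\<close> mono_y)
  moreover have "\<forall>\<^sub>F s in at_left t. (- f s) * x 0 + (y s - g s) = x s"
    unfolding eventually_at_left_field
  proof (intro exI[of _ 0] conjI allI impI \<open>0 < t\<close>)
    fix s :: real assume "0 < s"
    then show "(- f s) * x 0 + (y s - g s) = x s"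
      using is_flowD[OF x, of 0 s] by (simp add: f_def g_def)
  qed
  ultimately show "\<exists>l. (x \<longlongrightarrow> l) (at_left t)"
    by (blast intro: Lim_transform_eventually)
qed

text \<open>Let \<open>s\<close> increase to \<open>t\<close> in the flow identity over
  \<open>(s,t]\<close>, whose value \<open>x t\<close> does not depend on \<open>s\<close>.\<close>

lemma flow_jump:
  assumes x: "is_flow x" and "0 < t"
  shows "x t = (1 - jump z t) * Lim (at_left t) x + jump y t"
proof -
  have "((\<lambda>s. damp z s t * x s + inflow y z s t) \<longlongrightarrow> (1 - jump z t) * Lim (at_left t) x + jump y t) (at_left t)"
    by (intro tendsto_intros damp_left_limit inflow_left_limit cadlag_nonneg_left flow_cadlag assms)
  moreover have "\<forall>\<^sub>F s in at_left t. damp z s t * x s + inflow y z s t = x t"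
    unfolding eventually_at_left_field
  proof (intro exI[of _ 0] conjI allI impI \<open>0 < t\<close>)
    fix s :: real assume "0 < s" "s < t"
    then show "damp z s t * x s + inflow y z s t = x t"
      using is_flowD[OF x, of s t] by simp
  qed
  ultimately have "((\<lambda>s. x t) \<longlongrightarrow> (1 - jump z t) * Lim (at_left t) x + jump y t) (at_left t)"
    by (rule Lim_transform_eventually)
  then show ?thesis by (simp add: tendsto_const_iff)
qed

text \<open>
  The defect of the equation over a short interval to the right is negligible against the
  increments of \<open>z\<close> and \<open>y\<close>, and the defect has no jumps; so it vanishes.
\<close>

lemma flow_solves:
  assumes x: "is_flow x" and "0 \<le> t"
  shows "x t = x 0 + (y t - y 0) - (LINT s:{0<..t}|interval_measure z. Lim (at_left s) x)"
proof -
  note cadlag = flow_cadlag[OF x]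
  define I where "I a b = (LINT s:{a<..b}|interval_measure z. Lim (at_left s) x)" for a b
  define R where "R t = x t - x 0 - (y t - y 0) + I 0 t" for t
  \<comment> \<open>Measuring the defect \<open>R\<close> against total increments makes errors over
    adjacent intervals add up to the error over their union.\<close>
  define W where "W t = (z t - z 0) + (y t - y 0)" for t
  have I_split: "I 0 b = I 0 a + I a b" if "0 \<le> a" "a \<le> b" for a b
    unfolding I_def using that cadlag_nonneg_left_integrable[OF stieltjes cadlag]
    by (intro set_integral_split_Ioc) auto
  note I_near = cadlag_nonneg_left_near_const[OF stieltjes cadlag, folded I_def]
  have small: "\<bar>R t\<bar> \<le> e * W t" if "0 < e" for e
    using \<open>0 \<le> t\<close>
  proof (induction rule: real_induct_ge)
    case (right t)
    \<comment> \<open>With the weight \<open>\<bar>x t\<bar> + 1\<close> a single choice of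
      \<open>b\<close> makes both \<open>d * \<bar>x t\<bar>\<close> and \<open>d\<close> at most
      \<open>e / 2\<close>.\<close>
    have "((\<lambda>s. (z s - z t) * (\<bar>x t\<bar> + 1)) \<longlongrightarrow> (z t - z t) * (\<bar>x t\<bar> + 1)) (at_right t)"
      by (intro tendsto_intros stieltjesD(4)[OF stieltjes])
    then have "\<forall>\<^sub>F s in at_right t. (z s - z t) * (\<bar>x t\<bar> + 1) < e / 2"
      by (rule order_tendstoD(2)) (use \<open>0 < e\<close> in simp)
    moreover have "\<forall>\<^sub>F s in at_right t. dist (x s) (x t) < e / 2"
      by (rule tendstoD[OF cadlag_nonneg_right[OF cadlag right(1)]]) (use \<open>0 < e\<close> in simp)
    ultimately have "\<forall>\<^sub>F s in at_right t. (z s - z t) * (\<bar>x t\<bar> + 1) < e / 2 \<and> dist (x s) (x t) < e / 2"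
      by (rule eventually_conj)
    then obtain b where "b > t"
      and b: "\<And>s. t < s \<Longrightarrow> s < b \<Longrightarrow> (z s - z t) * (\<bar>x t\<bar> + 1) < e / 2 \<and> \<bar>x s - x t\<bar> < e / 2"
      by (auto simp: eventually_at_right_field dist_real_def)
    have "\<bar>R s\<bar> \<le> e * W s" if s: "t < s" "s < b" for s
    proof -
      define d where "d = z s - z t"
      define h where "h = y s - y t"
      have d: "0 \<le> d" and h: "0 \<le> h" using s z_le[of t s] y_le[of t s] by (auto simp: d_def h_def)
      have de: "d * \<bar>x t\<bar> \<le> e / 2" "d \<le> e / 2"
        using b[OF s] d mult_nonneg_nonneg[OF d abs_ge_zero[of "x t"]]
        unfolding d_def[symmetric] distrib_left by linarith+
      have "x s = damp z t s * x t + inflow y z t s"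
        using right(1) s by (intro is_flowD[OF x]) auto
      \<comment> \<open>Three errors: the damping factor against its linear part, of order
        \<open>d * d\<close>; the inflow against the undamped increment \<open>h\<close>; the
        integral against its integrand frozen at \<open>x t\<close>.\<close>
      then have "R s - R t = (damp z t s - 1 + d) * x t + (inflow y z t s - h) + (I t s - x t * d)"
        using I_split[of t s] right(1) s by (simp add: R_def d_def h_def algebra_simps)
      moreover have "\<bar>(damp z t s - 1 + d) * x t\<bar> \<le> d * (e / 2)"
      proof -
        have "\<bar>damp z t s - 1 + d\<bar> \<le> d * d"
          using damp_lower[of t s] damp_upper[of t s] s by (auto simp: d_def power2_eq_square)
        then have "\<bar>(damp z t s - 1 + d) * x t\<bar> \<le> d * d * \<bar>x t\<bar>"
          by (auto simp: abs_mult intro: mult_right_mono)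
        also have "\<dots> \<le> d * (e / 2)"
          using mult_left_mono[OF de(1) d] by (simp add: mult.assoc)
        finally show ?thesis .
      qed
      moreover have "\<bar>inflow y z t s - h\<bar> \<le> e * h"
      proof -
        have "(1 - d) * h \<le> damp z t s * h"
          using damp_lower[of t s] s h by (intro mult_right_mono) (auto simp: d_def)
        also have "\<dots> \<le> inflow y z t s"
          using inflow_ge[of t s] s by (simp add: h_def)
        finally have "h - inflow y z t s \<le> d * h" by (simp add: algebra_simps)
        also have "\<dots> \<le> e * h"
          using de(2) h \<open>0 < e\<close> by (intro mult_right_mono) auto
        finally show ?thesis using inflow_le[of t s] s mult_nonneg_nonneg[of e h] h \<open>0 < e\<close> by (simp add: h_def)
      qed
      moreover have "\<bar>I t s - x t * d\<bar> \<le> e / 2 * d"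
        unfolding d_def using right(1) s b by (intro I_near) (auto intro: less_imp_le)
      moreover have "d * (e / 2) + e / 2 * d = e * d" by (simp add: field_simps)
      ultimately have "\<bar>R s - R t\<bar> \<le> e * d + e * h" by linarith
      moreover have "\<bar>R t\<bar> \<le> e * W t" using right by simp
      ultimately have "\<bar>R s\<bar> \<le> e * d + e * h + e * W t" by linarith
      then show ?thesis by (simp add: W_def d_def h_def algebra_simps)
    qed
    then show ?case using \<open>b > t\<close> by (auto simp: eventually_at_right_field)
  next
    case (left t)
    show ?case
    proof (cases "t = 0")
      case True
      then show ?thesis by (simp add: R_def W_def I_def set_lebesgue_integral_def)
    next
      case False
      then have "0 < t" using left(1) by simp
      define L where "L = Lim (at_left t) x"
      have L: "(x \<longlongrightarrow> L) (at_left t)"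
        unfolding L_def by (rule cadlag_nonneg_left[OF cadlag \<open>0 < t\<close>])
      have "((\<lambda>s. I s t - L * (z t - z s)) \<longlongrightarrow> 0) (at_left t)"
      proof (rule tendstoI)
        fix r :: real assume "0 < r"
        \<comment> \<open>The \<open>+ 1\<close> keeps the denominator positive when
          \<open>z\<close> is constant on \<open>[0,t]\<close>.\<close>
        define r' where "r' = r / (z t - z 0 + 1)"
        have "0 < z t - z 0 + 1" using z_le[of 0 t] \<open>0 < t\<close> by simp
        then have r': "0 < r'" "r' * (z t - z 0) < r" using \<open>0 < r\<close> by (auto simp: r'_def field_simps)
        obtain b where "b < t" and b: "\<And>s. b < s \<Longrightarrow> s < t \<Longrightarrow> \<bar>x s - L\<bar> < r'"
          using tendstoD[OF L r'(1)] by (auto simp: eventually_at_left_field dist_real_def)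
        have "\<bar>I s t - L * (z t - z s)\<bar> < r" if "max 0 b < s" "s < t" for s
        proof -
          have "\<bar>I s t - L * (z t - z s)\<bar> \<le> r' * (z t - z s)"
            using that b by (intro I_near) (auto intro: less_imp_le)
          also have "\<dots> \<le> r' * (z t - z 0)"
            using r' that z_le[of 0 s] by (intro mult_left_mono) auto
          finally show ?thesis using r'(2) by simp
        qed
        then show "\<forall>\<^sub>F s in at_left t. dist (I s t - L * (z t - z s)) 0 < r"
          unfolding eventually_at_left_field using \<open>b < t\<close> \<open>0 < t\<close>
          by (intro exI[of _ "max 0 b"]) (auto simp: dist_real_def)
      qed
      from tendsto_add[OF this tendsto_mult[OF tendsto_const tendsto_diff[OF tendsto_const left_limit_mono[OF mono_z]]], of L "z t"]
      have I_lim: "((\<lambda>s. I s t) \<longlongrightarrow> L * jump z t) (at_left t)" by (simp add: jump_def)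
      have "((\<lambda>s. x s - x 0 - (y s - y 0) + (I 0 t - I s t)) \<longlongrightarrow>
          L - x 0 - (Lim (at_left t) y - y 0) + (I 0 t - L * jump z t)) (at_left t)"
        by (intro tendsto_intros L I_lim left_limit_mono mono_y)
      \<comment> \<open>By \<open>flow_jump\<close> the jumps of \<open>x\<close>, \<open>y\<close>
        and the integral at \<open>t\<close> cancel: the left limit of the defect is its value, and
        the bound passes to \<open>t\<close>.\<close>
      also have "L - x 0 - (Lim (at_left t) y - y 0) + (I 0 t - L * jump z t) = R t"
        using flow_jump[OF x \<open>0 < t\<close>] by (simp add: R_def L_def jump_def[of y] algebra_simps)
      finally have "((\<lambda>s. \<bar>x s - x 0 - (y s - y 0) + (I 0 t - I s t)\<bar>) \<longlongrightarrow> \<bar>R t\<bar>) (at_left t)"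
        by (rule tendsto_rabs)
      then show ?thesis
      proof (rule tendsto_upperbound)
        show "\<forall>\<^sub>F s in at_left t. \<bar>x s - x 0 - (y s - y 0) + (I 0 t - I s t)\<bar> \<le> e * W t"
          unfolding eventually_at_left_field
        proof (intro exI[of _ 0] conjI allI impI \<open>0 < t\<close>)
          fix s assume s: "0 < s" "s < t"
          then have "\<bar>R s\<bar> \<le> e * W s" using left(2)[of s] by simp
          also have "\<dots> \<le> e * W t"
            using s \<open>0 < e\<close> z_le[of s t] y_le[of s t] by (intro mult_left_mono) (auto simp: W_def)
          finally show "\<bar>x s - x 0 - (y s - y 0) + (I 0 t - I s t)\<bar> \<le> e * W t"
            using I_split[of s t] s by (simp add: R_def)
        qed
      qed simp
    qed
  qed
  have "0 \<le> W t" using z_le[OF \<open>0 \<le> t\<close>] y_le[OF \<open>0 \<le> t\<close>] by (simp add: W_def)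
  have "\<bar>R t\<bar> \<le> 0 + e" if "0 < e" for e
  proof -
    have "\<bar>R t\<bar> \<le> e / (W t + 1) * W t"
      using that \<open>0 \<le> W t\<close> by (intro small) simp
    also have "\<dots> \<le> e" using that \<open>0 \<le> W t\<close> by (simp add: field_simps)
    finally show ?thesis by simp
  qed
  then have "\<bar>R t\<bar> \<le> 0" by (rule field_le_epsilon)
  then show ?thesis by (simp add: R_def I_def)
qed

end

section \<open>The stationary solution along a path\<close>

definition xstar :: "(real \<Rightarrow> real) \<Rightarrow> (real \<Rightarrow> real) \<Rightarrow> real \<Rightarrow> real" where
  "xstar y z t = (LINT s:{..t}|interval_measure y. damp z s t)"

lemma X_star_eq: "X_star Y Z t \<omega> = xstar (\<lambda>s. Y s \<omega>) (\<lambda>s. Z s \<omega>) t"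
  by (simp add: X_star_def xstar_def damp_def Let_def)

context flow_path
begin

text \<open>Valid without any finiteness: where the supremum is infinite, the Lebesgue integral and
  \<open>enn2real\<close> both default to \<open>0\<close>. Measurability and shift equivariance of
  \<open>xstar\<close> therefore hold on all regular paths, with no exceptional set.\<close>

lemma xstar_SUP: "xstar y z t = enn2real (SUP n. ennreal (inflow y z (t - real n) t))"
proof -
  let ?f = "\<lambda>n s. ennreal (indicator {t - real n<..t} s * damp z s t)"
  have "xstar y z t = enn2real (\<integral>\<^sup>+s. ennreal (indicator {..t} s * damp z s t) \<partial>interval_measure y)"
    unfolding xstar_def set_lebesgue_integral_def
    by (subst integral_eq_nn_integral) (auto simp: damp_nonneg)
  also have "(\<lambda>s. ennreal (indicator {..t} s * damp z s t)) = (\<lambda>s. SUP n. ?f n s)"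
  proof
    fix s
    obtain n where "t - s < real n" using reals_Archimedean2 by blast
    then have n: "indicator {..t} s = (indicator {t - real n<..t} s :: real)"
      by (simp add: indicator_def)
    show "ennreal (indicator {..t} s * damp z s t) = (SUP n. ?f n s)"
    proof (rule antisym)
      show "ennreal (indicator {..t} s * damp z s t) \<le> (SUP n. ?f n s)"
        unfolding n by (rule SUP_upper) simp
      show "(SUP n. ?f n s) \<le> ennreal (indicator {..t} s * damp z s t)"
        by (intro SUP_least ennreal_leI mult_right_mono) (auto simp: damp_nonneg indicator_def)
    qed
  qed
  also have "(\<integral>\<^sup>+s. (SUP n. ?f n s) \<partial>interval_measure y) = (SUP n. \<integral>\<^sup>+s. ?f n s \<partial>interval_measure y)"
  proof (rule nn_integral_monotone_convergence_SUP)
    show "incseq ?f"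
      by (auto intro!: incseq_SucI le_funI ennreal_leI mult_right_mono simp: damp_nonneg indicator_def)
  qed simp
  also have "\<dots> = (SUP n. ennreal (inflow y z (t - real n) t))"
  proof (rule SUP_cong[OF refl])
    fix n
    show "(\<integral>\<^sup>+s. ?f n s \<partial>interval_measure y) = ennreal (inflow y z (t - real n) t)"
      using damp_integrable[of t t "t - real n"]
      unfolding inflow_def set_integrable_def set_lebesgue_integral_def
      by (subst nn_integral_eq_integral) (auto simp: damp_nonneg)
  qed
  finally show ?thesis .
qed

definition finite_past :: bool where
  "finite_past \<longleftrightarrow> set_integrable (interval_measure y) {..0} (\<lambda>s. damp z s 0)"

text \<open>On \<open>{..0}\<close> the integrand is the one for time \<open>0\<close> times the
  constant \<open>damp z 0 t\<close>; on \<open>(0,t]\<close> it is bounded by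
  \<open>1\<close>.\<close>

lemma finite_past_integrable:
  assumes finite_past "0 \<le> t"
  shows "set_integrable (interval_measure y) {..t} (\<lambda>s. damp z s t)"
proof -
  have "set_integrable (interval_measure y) {..0} (\<lambda>s. damp z s 0 * damp z 0 t)"
    using assms(1) by (simp add: finite_past_def)
  also have "?this \<longleftrightarrow> set_integrable (interval_measure y) {..0} (\<lambda>s. damp z s t)"
  proof (rule set_integrable_cong)
    fix s :: real assume "s \<in> {..0}"
    then show "damp z s 0 * damp z 0 t = damp z s t"
      using damp_mult[of s 0 t] assms(2) by simp
  qed auto
  finally have "set_integrable (interval_measure y) ({..0} \<union> {0<..t}) (\<lambda>s. damp z s t)"
    by (rule set_integrable_Un[OF _ damp_integrable]) auto
  also have "{..0} \<union> {0<..t} = {..t}" using assms(2) by auto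
  finally show ?thesis .
qed

lemma xstar_flow:
  assumes finite_past
  shows "is_flow (xstar y z)"
  unfolding is_flow_def
proof (intro allI impI)
  fix a b :: real assume ab: "0 \<le> a" "a \<le> b"
  have "{..b} = {..a} \<union> {a<..b}" using ab by auto
  then have "xstar y z b = (LINT s:{..a}|interval_measure y. damp z s b) + inflow y z a b"
    unfolding xstar_def inflow_def using finite_past_integrable[OF assms, of b] ab
    by (simp only:) (rule set_integral_Un, auto intro: set_integrable_subset)
  moreover have "(LINT s:{..a}|interval_measure y. damp z s b) =
      (LINT s:{..a}|interval_measure y. damp z a b * damp z s a)"
  proof (rule set_lebesgue_integral_cong)
    show "\<forall>s. s \<in> {..a} \<longrightarrow> damp z s b = damp z a b * damp z s a"
    proof (intro allI impI)
      fix s assume "s \<in> {..a}"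
      then have "s \<le> a" by simp
      from damp_mult[OF this ab(2)] show "damp z s b = damp z a b * damp z s a"
        by (simp only: mult.commute)
    qed
  qed simp
  ultimately show "xstar y z b = damp z a b * xstar y z a + inflow y z a b"
    by (simp add: xstar_def)
qed

lemma inflow_tendsto_xstar:
  assumes finite_past
  shows "(\<lambda>n. inflow y z (- real n) 0) \<longlonglongrightarrow> xstar y z 0"
  unfolding inflow_def xstar_def set_lebesgue_integral_def
proof (rule integral_dominated_convergence)
  show "integrable (interval_measure y) (\<lambda>s. indicator {..0} s *\<^sub>R damp z s 0)"
    using assms by (simp add: finite_past_def set_integrable_def)
  show "AE s in interval_measure y. (\<lambda>n. indicator {- real n<..0} s *\<^sub>R damp z s 0) \<longlonglongrightarrow> indicator {..0} s *\<^sub>R damp z s 0"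
  proof (rule AE_I2)
    fix s
    obtain N where N: "- s < real N" using reals_Archimedean2 by blast
    show "(\<lambda>n. indicator {- real n<..0} s *\<^sub>R damp z s 0) \<longlonglongrightarrow> indicator {..0} s *\<^sub>R damp z s 0"
      by (rule tendsto_eventually, rule eventually_sequentiallyI[of N])
        (use N in \<open>auto simp: indicator_def\<close>)
  qed
  show "AE s in interval_measure y. norm (indicator {- real n<..0} s *\<^sub>R damp z s 0)
      \<le> indicator {..0} s *\<^sub>R damp z s 0" for n
    by (rule AE_I2) (auto simp: indicator_def damp_nonneg)
qed auto

lemma inflow_le_xstar:
  assumes finite_past "t \<le> 0"
  shows "inflow y z t 0 \<le> xstar y z 0"
proof (rule LIMSEQ_le_const[OF inflow_tendsto_xstar[OF assms(1)]])
  obtain N where "- t \<le> real N" using real_arch_simple by blast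
  then show "\<exists>N. \<forall>n\<ge>N. inflow y z t 0 \<le> inflow y z (- real n) 0"
    using assms(2) by (intro exI[of _ N] allI impI inflow_antimono) auto
qed

end

section \<open>The hypotheses of the theorem along one path\<close>

lemma J_path_0 [simp]: "J_path z 0 = 0"
  by (simp add: J_path_def cont_part_def signed_sum_def)

text \<open>Since \<open>J_path z\<close> vanishes at \<open>0\<close>, \<open>damp z s 0\<close> is
  at most \<open>exp (J_path z s)\<close>.\<close>

lemma (in flow_path) finite_pastI:
  assumes "(\<integral>\<^sup>+s\<in>{..0}. ennreal (exp (J_path z s)) \<partial>interval_measure y) < \<infinity>"
  shows finite_past
  unfolding finite_past_def set_integrable_def
proof (rule integrableI_bounded)
  have "(\<integral>\<^sup>+s. ennreal (norm (indicator {..0} s *\<^sub>R damp z s 0)) \<partial>interval_measure y)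
      \<le> (\<integral>\<^sup>+s\<in>{..0}. ennreal (exp (J_path z s)) \<partial>interval_measure y)"
    by (rule nn_integral_mono) (auto simp: indicator_def damp_def)
  then show "(\<integral>\<^sup>+s. ennreal (norm (indicator {..0} s *\<^sub>R damp z s 0)) \<partial>interval_measure y) < \<infinity>"
    using assms by (rule le_less_trans)
qed simp

text \<open>A unit jump at a positive time makes \<open>damp z 0\<close> vanish from then on;
  otherwise \<open>exp (- J_path z t)\<close> dominates it.\<close>

lemma (in damping_path) damp_tendsto_0:
  assumes "T1_path z < \<infinity> \<or> filterlim (J_path z) at_top at_top"
  shows "(damp z 0 \<longlongrightarrow> 0) at_top"
  using assms
proof
  assume "T1_path z < \<infinity>"
  then have "{t. 0 < t \<and> jump z t = 1} \<noteq> {}"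
    unfolding T1_path_def by (intro notI) (simp add: top_ereal_def)
  then obtain t where t: "0 < t" "jump z t = 1" by blast
  have "\<forall>\<^sub>F s in at_top. damp z 0 s = 0"
    using eventually_ge_at_top[of t]
    by eventually_elim (use t in \<open>auto intro: damp_eq_0[of t]\<close>)
  then show ?thesis by (rule tendsto_eventually)
next
  assume J: "filterlim (J_path z) at_top at_top"
  have "((\<lambda>t. exp (- J_path z t)) \<longlongrightarrow> 0) at_top"
    by (rule filterlim_compose[OF exp_at_bot]) (use J in \<open>simp add: filterlim_uminus_at_bot\<close>)
  then show ?thesis
  proof (rule Lim_null_comparison[rotated])
    show "\<forall>\<^sub>F t in at_top. norm (damp z 0 t) \<le> exp (- J_path z t)"
      by (intro always_eventually) (simp add: damp_def indicator_def)
  qed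
qed

section \<open>Shift equivariance\<close>

lemma filterlim_shift_at_left: "filterlim (\<lambda>u :: real. u + s) (at_left (t + s)) (at_left t)"
  unfolding filterlim_at by (auto intro!: tendsto_intros simp: eventually_at_filter)

lemma filterlim_shift_at_right: "filterlim (\<lambda>u :: real. u + s) (at_right (t + s)) (at_right t)"
  unfolding filterlim_at by (auto intro!: tendsto_intros simp: eventually_at_filter)

lemma stieltjes_shift:
  assumes "stieltjes F"
  shows "stieltjes (\<lambda>t. F (t + s) - F s)"
  unfolding stieltjes_def continuous_within
proof (intro conjI allI)
  show "mono (\<lambda>t. F (t + s) - F s)" by (intro monoI) (simp add: stieltjesD(2)[OF assms])
  show "((\<lambda>t. F (t + s) - F s) \<longlongrightarrow> F (t + s) - F s) (at_right t)" for t
    by (intro tendsto_diff tendsto_const filterlim_compose[OF stieltjesD(4)[OF assms] filterlim_shift_at_right])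
qed

lemma jump_shift:
  assumes "mono z"
  shows "jump (\<lambda>t. z (t + s) - z s) t = jump z (t + s)"
proof -
  have "((\<lambda>t. z (t + s) - z s) \<longlongrightarrow> Lim (at_left (t + s)) z - z s) (at_left t)"
    by (intro tendsto_diff tendsto_const filterlim_compose[OF left_limit_mono[OF assms] filterlim_shift_at_left])
  then have "Lim (at_left t) (\<lambda>t. z (t + s) - z s) = Lim (at_left (t + s)) z - z s"
    by (intro tendsto_Lim) simp_all
  then show ?thesis by (simp add: jump_def)
qed

lemma (in damping_path) damping_path_shift: "damping_path (\<lambda>t. z (t + s) - z s)"
  by unfold_locales (simp_all add: stieltjes_shift stieltjes jump_shift[OF mono_z] jump_le_1)

text \<open>Both sides are limits of the same products: grids shift along with the interval, and
  subtracting \<open>z s\<close> leaves increments unchanged.\<close>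

lemma (in damping_path) damp_shift:
  assumes "a \<le> b"
  shows "damp (\<lambda>t. z (t + s) - z s) a b = damp z (a + s) (b + s)"
  using damping_path.damp_prod_limit[OF damping_path_shift assms] damp_prod_limit[of "a + s" "b + s"] assms
  by (intro LIMSEQ_unique) (simp_all add: grid_shift)

context flow_path
begin

lemma flow_path_shift: "flow_path (\<lambda>t. z (t + s) - z s) (\<lambda>t. y (t + s) - y s)"
  using damping_path_shift stieltjes_shift[OF stieltjes_y]
  by (simp add: flow_path_def flow_path_axioms_def)

lemma inflow_shift:
  assumes "a \<le> b"
  shows "inflow (\<lambda>t. y (t + s) - y s) (\<lambda>t. z (t + s) - z s) a b = inflow y z (a + s) (b + s)"
proof (rule LIMSEQ_unique)
  show "(\<lambda>n. \<Sum>i\<le>n. damp z (grid a b n (Suc i) + s) (b + s) * (y (grid a b n (Suc i) + s) - y (grid a b n i + s)))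
      \<longlonglongrightarrow> inflow y z (a + s) (b + s)"
    using inflow_sum_limit[of "a + s" "b + s"] assms by (simp add: grid_shift)
  have "(\<Sum>i\<le>n. damp z (grid a b n (Suc i) + s) (b + s) * (y (grid a b n (Suc i) + s) - y (grid a b n i + s))) =
      (\<Sum>i\<le>n. damp (\<lambda>t. z (t + s) - z s) (grid a b n (Suc i)) b *
        ((y (grid a b n (Suc i) + s) - y s) - (y (grid a b n i + s) - y s)))" for n
    by (rule sum.cong[OF refl]) (simp add: damp_shift grid_bounds(2)[OF assms])
  then show "(\<lambda>n. \<Sum>i\<le>n. damp z (grid a b n (Suc i) + s) (b + s) * (y (grid a b n (Suc i) + s) - y (grid a b n i + s)))
      \<longlonglongrightarrow> inflow (\<lambda>t. y (t + s) - y s) (\<lambda>t. z (t + s) - z s) a b"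
    using flow_path.inflow_sum_limit[OF flow_path_shift assms, of s] by (simp only:)
qed

lemma xstar_shift:
  "xstar (\<lambda>t. y (t + s) - y s) (\<lambda>t. z (t + s) - z s) t = xstar y z (t + s)"
  unfolding xstar_SUP flow_path.xstar_SUP[OF flow_path_shift]
  by (simp add: inflow_shift algebra_simps)

end

section \<open>Laws of stationary processes\<close>

lemma PiM_borel_generator:
  fixes I :: "'i set"
  defines "\<Omega> \<equiv> space (\<Pi>\<^sub>M i\<in>I. (borel :: real measure))"
  defines "G \<equiv> {{p \<in> \<Omega>. \<forall>j\<in>J. p j \<le> a j} | J (a :: 'i \<Rightarrow> real). finite J \<and> J \<subseteq> I}"
  shows "sets (\<Pi>\<^sub>M i\<in>I. (borel :: real measure)) = sigma_sets \<Omega> G" and "Int_stable G"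
proof -
  let ?P = "\<Pi>\<^sub>M i\<in>I. (borel :: real measure)"
  have G: "{p \<in> \<Omega>. \<forall>j\<in>J. p j \<le> a j} \<in> G" if "finite J" "J \<subseteq> I" for J and a :: "'i \<Rightarrow> real"
    using that by (auto simp: G_def)
  have Pow: "G \<subseteq> Pow \<Omega>" by (auto simp: G_def)
  show "sets ?P = sigma_sets \<Omega> G"
  proof (rule antisym)
    have "G \<subseteq> sets ?P"
    proof
      fix A assume "A \<in> G"
      then obtain J a where A: "A = {p \<in> \<Omega>. \<forall>j\<in>J. p j \<le> a j}" "finite J" "J \<subseteq> I"
        by (auto simp: G_def)
      have [measurable]: "(\<lambda>p. p j) \<in> borel_measurable ?P" if "j \<in> J" for j
        using that A(3) by (intro measurable_component_singleton) auto
      show "A \<in> sets ?P"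
        unfolding A(1) \<Omega>_def using A(2) by measurable
    qed
    then show "sigma_sets \<Omega> G \<subseteq> sets ?P"
      unfolding \<Omega>_def by (rule sets.sigma_sets_subset)
    have "(\<lambda>p i. p i) \<in> measurable (sigma \<Omega> G) ?P"
    proof (rule measurable_PiM_single')
      fix i assume "i \<in> I"
      show "(\<lambda>p. p i) \<in> borel_measurable (sigma \<Omega> G)"
      proof (rule borel_measurableI_le)
        fix c
        show "{p \<in> space (sigma \<Omega> G). p i \<le> c} \<in> sets (sigma \<Omega> G)"
          using G[of "{i}" "\<lambda>_. c"] \<open>i \<in> I\<close> Pow by (auto simp: sets_measure_of)
      qed
    qed (use Pow in \<open>auto simp: \<Omega>_def space_PiM\<close>)
    note identity = this
    have "(\<lambda>p. p) -` A \<inter> \<Omega> \<in> sigma_sets \<Omega> G" if "A \<in> sets ?P" for A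
      using measurable_sets[OF identity that] Pow by (simp add: space_measure_of sets_measure_of)
    then show "sets ?P \<subseteq> sigma_sets \<Omega> G"
      using sets.sets_into_space[of _ ?P] by (auto simp: \<Omega>_def Int_absorb2)
  qed
  show "Int_stable G"
  proof (rule Int_stableI)
    fix A B assume "A \<in> G" "B \<in> G"
    then obtain J a K b where A: "A = {p \<in> \<Omega>. \<forall>j\<in>J. p j \<le> a j}" "finite J" "J \<subseteq> I"
      and B: "B = {p \<in> \<Omega>. \<forall>j\<in>K. p j \<le> b j}" "finite K" "K \<subseteq> I"
      by (auto simp: G_def)
    \<comment> \<open>The smaller threshold where both sets constrain a coordinate, the only one
      otherwise.\<close>
    define c where "c j = (if j \<in> J then if j \<in> K then min (a j) (b j) else a j else b j)" for j
    have "A \<inter> B = {p \<in> \<Omega>. \<forall>j\<in>J \<union> K. p j \<le> c j}"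
      unfolding A(1) B(1) c_def by (auto split: if_splits)
    also have "\<dots> \<in> G" using A B by (intro G) auto
    finally show "A \<inter> B \<in> G" .
  qed
qed

lemma law_eqI_cdf:
  fixes X X' :: "'i \<Rightarrow> 'a \<Rightarrow> real"
  assumes "prob_space M"
    and X: "\<And>i. i \<in> I \<Longrightarrow> X i \<in> borel_measurable M" and X': "\<And>i. i \<in> I \<Longrightarrow> X' i \<in> borel_measurable M"
    and eq: "\<And>J a. finite J \<Longrightarrow> J \<subseteq> I \<Longrightarrow>
      measure M {\<omega> \<in> space M. \<forall>j\<in>J. X j \<omega> \<le> a j} = measure M {\<omega> \<in> space M. \<forall>j\<in>J. X' j \<omega> \<le> a j}"
  shows "distr M (\<Pi>\<^sub>M i\<in>I. borel) (\<lambda>\<omega>. \<lambda>i\<in>I. X i \<omega>) = distr M (\<Pi>\<^sub>M i\<in>I. borel) (\<lambda>\<omega>. \<lambda>i\<in>I. X' i \<omega>)"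
    (is "distr M ?P ?X = distr M ?P ?X'")
proof -
  interpret prob_space M by fact
  have meas: "?X \<in> measurable M ?P" "?X' \<in> measurable M ?P"
    using X X' by (auto intro: measurable_restrict)
  let ?\<Omega> = "space ?P"
  let ?G = "{{p \<in> ?\<Omega>. \<forall>j\<in>J. p j \<le> a j} | J (a :: 'i \<Rightarrow> real). finite J \<and> J \<subseteq> I}"
  show ?thesis
  proof (rule measure_eqI_generator_eq[where E = ?G and \<Omega> = ?\<Omega> and A = "\<lambda>_. ?\<Omega>"])
    show "Int_stable ?G" by (rule PiM_borel_generator(2))
    show "sets (distr M ?P ?X) = sigma_sets ?\<Omega> ?G" "sets (distr M ?P ?X') = sigma_sets ?\<Omega> ?G"
      using PiM_borel_generator(1)[of I] by simp_all
    show "range (\<lambda>_ :: nat. ?\<Omega>) \<subseteq> ?G"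
      by (auto intro!: exI[of _ "{}"])
    show "emeasure (distr M ?P ?X) ?\<Omega> \<noteq> \<infinity>"
      using prob_space.emeasure_le_1[OF prob_space_distr[OF meas(1)], of ?\<Omega>] by (auto simp: top_unique)
    fix A assume "A \<in> ?G"
    then obtain J a where A: "A = {p \<in> ?\<Omega>. \<forall>j\<in>J. p j \<le> a j}" "finite J" "J \<subseteq> I"
      by auto
    have "A \<in> sets ?P"
      using \<open>A \<in> ?G\<close> unfolding PiM_borel_generator(1) by (rule sigma_sets.Basic)
    have "?X -` A \<inter> space M = {\<omega> \<in> space M. \<forall>j\<in>J. X j \<omega> \<le> a j}"
      "?X' -` A \<inter> space M = {\<omega> \<in> space M. \<forall>j\<in>J. X' j \<omega> \<le> a j}"
      using A(3) by (auto simp: A(1) space_PiM)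
    then show "emeasure (distr M ?P ?X) A = emeasure (distr M ?P ?X') A"
      using eq[OF A(2,3), of a] \<open>A \<in> sets ?P\<close> meas by (simp add: emeasure_distr emeasure_eq_measure)
  qed auto
qed

text \<open>A Lipschitz substitute for the indicator of \<open>{..0}\<close>: for
  \<open>k > 0\<close> it is \<open>1\<close> up to \<open>0\<close>, \<open>0\<close> from
  \<open>1 / k\<close> on, and linear in between. Closeness of two processes controls differences of
  such functions, but not of indicators.\<close>

definition ramp :: "nat \<Rightarrow> real \<Rightarrow> real" where
  "ramp k u = max 0 (min 1 (1 - real k * u))"

lemma ramp_bounds: "0 \<le> ramp k u" "ramp k u \<le> 1" "\<bar>ramp k u\<bar> \<le> 1"
  by (auto simp: ramp_def)

lemma ramp_lipschitz: "\<bar>ramp k u - ramp k v\<bar> \<le> real k * \<bar>u - v\<bar>"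
proof -
  have "\<bar>ramp k u - ramp k v\<bar> \<le> \<bar>real k * u - real k * v\<bar>" by (simp add: ramp_def)
  also have "\<dots> = real k * \<bar>u - v\<bar>" by (simp add: abs_mult flip: right_diff_distrib)
  finally show ?thesis .
qed

lemma ramp_measurable [measurable]: "ramp k \<in> borel_measurable borel"
  unfolding ramp_def by measurable

lemma ramp_tendsto: "(\<lambda>k. ramp k u) \<longlonglongrightarrow> indicator {..0} u"
proof (cases "u \<le> 0")
  case True
  then have "ramp k u = 1" for k
    using mult_nonneg_nonpos[of "real k" u] by (simp add: ramp_def)
  then show ?thesis using True by simp
next
  case False
  then obtain K where K: "1 / u \<le> real K" using real_arch_simple by blast
  have "ramp k u = 0" if "k \<ge> K" for k
  proof -
    have "1 / u \<le> real k" using K that by linarith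
    then have "1 \<le> real k * u" using False by (simp add: field_simps)
    then show ?thesis by (simp add: ramp_def)
  qed
  then show ?thesis using False by (intro tendsto_eventually eventually_sequentiallyI[of K]) simp
qed

text \<open>
  By stationarity the expectations of Lipschitz functions of finitely many coordinates can be
  computed at arbitrarily late times, where the two processes are close.
\<close>

lemma stationary_law_eq:
  assumes "prob_space M"
    and X: "\<And>t. 0 \<le> t \<Longrightarrow> X t \<in> borel_measurable M" and X': "\<And>t. 0 \<le> t \<Longrightarrow> X' t \<in> borel_measurable M"
    and stat: "stationary_nonneg M X" "stationary_nonneg M X'"
    and close: "AE \<omega> in M. \<forall>t\<ge>0. (\<lambda>n. X (t + real n) \<omega> - X' (t + real n) \<omega>) \<longlonglongrightarrow> 0"
  shows "law_nonneg M X = law_nonneg M X'"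
proof -
  interpret prob_space M by fact
  define \<Phi> where "\<Phi> J a k p = (\<Prod>j\<in>J. ramp k (p j - a j))" for J :: "real set" and a k and p :: "real \<Rightarrow> real"
  have \<Phi>_bound: "\<bar>\<Phi> J a k p\<bar> \<le> 1" for J a k p
    unfolding \<Phi>_def by (simp add: abs_prod ramp_bounds prod_le_1)
  have \<Phi>_meas: "(\<lambda>\<omega>. \<Phi> J a k (\<lambda>t. U (t + s) \<omega>)) \<in> borel_measurable M"
    if "J \<subseteq> {0..}" "\<And>t. 0 \<le> t \<Longrightarrow> U t \<in> borel_measurable M" "0 \<le> s" for J a k s and U :: "real \<Rightarrow> 'a \<Rightarrow> real"
    unfolding \<Phi>_def using that
    by (intro borel_measurable_prod measurable_compose[OF _ ramp_measurable] borel_measurable_diff) auto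
  have shift: "(\<integral>\<omega>. \<Phi> J a k (\<lambda>t. U (t + s) \<omega>) \<partial>M) = (\<integral>\<omega>. \<Phi> J a k (\<lambda>t. U t \<omega>) \<partial>M)"
    if J: "J \<subseteq> {0..}" and U: "\<And>t. 0 \<le> t \<Longrightarrow> U t \<in> borel_measurable M" "stationary_nonneg M U" and "0 \<le> s"
    for J a k s and U :: "real \<Rightarrow> 'a \<Rightarrow> real"
  proof -
    let ?P = "\<Pi>\<^sub>M t\<in>{0..}. (borel :: real measure)"
    have [measurable]: "\<Phi> J a k \<in> borel_measurable ?P"
      unfolding \<Phi>_def using J
      by (intro borel_measurable_prod measurable_compose[OF _ ramp_measurable] borel_measurable_diff
          measurable_component_singleton) auto
    have law: "(\<integral>p. \<Phi> J a k p \<partial>law_nonneg M (\<lambda>t. U (t + r))) = (\<integral>\<omega>. \<Phi> J a k (\<lambda>t. U (t + r) \<omega>) \<partial>M)"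
      if "0 \<le> r" for r
    proof -
      have "(\<lambda>\<omega>. \<lambda>t\<in>{0..}. U (t + r) \<omega>) \<in> measurable M ?P"
        using U(1) that by (intro measurable_restrict) auto
      moreover have "\<Phi> J a k (\<lambda>t\<in>{0..}. U (t + r) \<omega>) = \<Phi> J a k (\<lambda>t. U (t + r) \<omega>)" for \<omega>
        unfolding \<Phi>_def using J by (intro prod.cong) auto
      ultimately show ?thesis by (simp add: law_nonneg_def integral_distr)
    qed
    show ?thesis using law[OF \<open>0 \<le> s\<close>] law[of 0] U(2) \<open>0 \<le> s\<close> by (simp add: stationary_nonneg_def)
  qed
  have eq: "(\<integral>\<omega>. \<Phi> J a k (\<lambda>t. X t \<omega>) \<partial>M) = (\<integral>\<omega>. \<Phi> J a k (\<lambda>t. X' t \<omega>) \<partial>M)"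
    if J: "J \<subseteq> {0..}" for J a k
  proof -
    let ?d = "\<lambda>n \<omega>. \<Phi> J a k (\<lambda>t. X (t + real n) \<omega>) - \<Phi> J a k (\<lambda>t. X' (t + real n) \<omega>)"
    have "(\<lambda>n. \<integral>\<omega>. ?d n \<omega> \<partial>M) \<longlonglongrightarrow> (\<integral>\<omega>. 0 \<partial>M)"
    proof (rule integral_dominated_convergence[where w = "\<lambda>_. 2"])
      show "?d n \<in> borel_measurable M" for n
        using J X X' by (intro borel_measurable_diff \<Phi>_meas) auto
      show "AE \<omega> in M. (\<lambda>n. ?d n \<omega>) \<longlonglongrightarrow> 0"
        using close
      proof eventually_elim
        fix \<omega> assume lim: "\<forall>t\<ge>0. (\<lambda>n. X (t + real n) \<omega> - X' (t + real n) \<omega>) \<longlonglongrightarrow> 0"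
        have "(\<lambda>n. \<Sum>j\<in>J. real k * \<bar>X (j + real n) \<omega> - X' (j + real n) \<omega>\<bar>) \<longlonglongrightarrow> (\<Sum>j\<in>J. real k * \<bar>0\<bar>)"
          using lim J by (intro tendsto_intros) auto
        then have "(\<lambda>n. \<Sum>j\<in>J. real k * \<bar>X (j + real n) \<omega> - X' (j + real n) \<omega>\<bar>) \<longlonglongrightarrow> 0" by simp
        then show "(\<lambda>n. ?d n \<omega>) \<longlonglongrightarrow> 0"
        proof (rule Lim_null_comparison[OF always_eventually, rotated], intro allI)
          fix n
          have "norm (?d n \<omega>) \<le> (\<Sum>j\<in>J. norm (ramp k (X (j + real n) \<omega> - a j) - ramp k (X' (j + real n) \<omega> - a j)))"
            unfolding \<Phi>_def by (intro norm_prod_diff) (simp_all add: ramp_bounds)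
          also have "\<dots> \<le> (\<Sum>j\<in>J. real k * \<bar>X (j + real n) \<omega> - X' (j + real n) \<omega>\<bar>)"
          proof (rule sum_mono)
            fix j
            show "norm (ramp k (X (j + real n) \<omega> - a j) - ramp k (X' (j + real n) \<omega> - a j)) \<le> real k * \<bar>X (j + real n) \<omega> - X' (j + real n) \<omega>\<bar>"
              using ramp_lipschitz[of k "X (j + real n) \<omega> - a j" "X' (j + real n) \<omega> - a j"] by simp
          qed
          finally show "norm (?d n \<omega>) \<le> (\<Sum>j\<in>J. real k * \<bar>X (j + real n) \<omega> - X' (j + real n) \<omega>\<bar>)" .
        qed
      qed
      show "AE \<omega> in M. norm (?d n \<omega>) \<le> 2" for n
      proof (rule AE_I2)
        fix \<omega>
        show "norm (?d n \<omega>) \<le> 2"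
          using \<Phi>_bound[of J a k "\<lambda>t. X (t + real n) \<omega>"] \<Phi>_bound[of J a k "\<lambda>t. X' (t + real n) \<omega>"]
          unfolding real_norm_def by linarith
      qed
    qed auto
    \<comment> \<open>By stationarity this expectation does not depend on \<open>n\<close>; a
      constant sequence that tends to \<open>0\<close> is \<open>0\<close>.\<close>
    moreover have "(\<integral>\<omega>. ?d n \<omega> \<partial>M) = (\<integral>\<omega>. \<Phi> J a k (\<lambda>t. X t \<omega>) \<partial>M) - (\<integral>\<omega>. \<Phi> J a k (\<lambda>t. X' t \<omega>) \<partial>M)" for n
    proof -
      have "integrable M (\<lambda>\<omega>. \<Phi> J a k (\<lambda>t. X (t + real n) \<omega>))" "integrable M (\<lambda>\<omega>. \<Phi> J a k (\<lambda>t. X' (t + real n) \<omega>))"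
        using J X X' \<Phi>_bound by (auto intro!: integrable_const_bound[where B = 1] \<Phi>_meas)
      then show ?thesis
        using shift[OF J X stat(1), of "real n" a k] shift[OF J X' stat(2), of "real n" a k] by simp
    qed
    ultimately show ?thesis by (simp add: LIMSEQ_const_iff)
  qed
  show ?thesis
    unfolding law_nonneg_def
  proof (rule law_eqI_cdf[OF \<open>prob_space M\<close>])
    fix J :: "real set" and a :: "real \<Rightarrow> real"
    assume J: "finite J" "J \<subseteq> {0..}"
    \<comment> \<open>Letting \<open>k\<close> grow recovers the joint distribution function from
      the expectations of the cutoffs.\<close>
    have lim: "(\<lambda>k. \<integral>\<omega>. \<Phi> J a k (\<lambda>t. U t \<omega>) \<partial>M) \<longlonglongrightarrow> measure M {\<omega> \<in> space M. \<forall>j\<in>J. U j \<omega> \<le> a j}"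
      if U: "\<And>t. 0 \<le> t \<Longrightarrow> U t \<in> borel_measurable M" for U :: "real \<Rightarrow> 'a \<Rightarrow> real"
    proof -
      have [measurable]: "U j \<in> borel_measurable M" if "j \<in> J" for j using U J(2) that by auto
      have set: "{\<omega> \<in> space M. \<forall>j\<in>J. U j \<omega> \<le> a j} \<in> sets M" using J(1) by measurable
      have "(\<lambda>k. \<integral>\<omega>. \<Phi> J a k (\<lambda>t. U t \<omega>) \<partial>M) \<longlonglongrightarrow> (\<integral>\<omega>. indicator {\<omega> \<in> space M. \<forall>j\<in>J. U j \<omega> \<le> a j} \<omega> \<partial>M)"
      proof (rule integral_dominated_convergence[where w = "\<lambda>_. 1"])
        show "(\<lambda>\<omega>. \<Phi> J a k (\<lambda>t. U t \<omega>)) \<in> borel_measurable M" for k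
          using \<Phi>_meas[OF J(2) U order_refl] by simp
        show "AE \<omega> in M. (\<lambda>k. \<Phi> J a k (\<lambda>t. U t \<omega>)) \<longlonglongrightarrow> indicator {\<omega> \<in> space M. \<forall>j\<in>J. U j \<omega> \<le> a j} \<omega>"
        proof (rule AE_I2)
          fix \<omega> assume "\<omega> \<in> space M"
          have "(\<lambda>k. \<Phi> J a k (\<lambda>t. U t \<omega>)) \<longlonglongrightarrow> (\<Prod>j\<in>J. indicator {..0} (U j \<omega> - a j))"
            unfolding \<Phi>_def by (intro tendsto_prod ramp_tendsto)
          also have "(\<Prod>j\<in>J. indicator {..0} (U j \<omega> - a j)) = (indicator {\<omega> \<in> space M. \<forall>j\<in>J. U j \<omega> \<le> a j} \<omega> :: real)"
            using \<open>\<omega> \<in> space M\<close> J(1) by (auto simp: indicator_def not_le)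
          finally show "(\<lambda>k. \<Phi> J a k (\<lambda>t. U t \<omega>)) \<longlonglongrightarrow> indicator {\<omega> \<in> space M. \<forall>j\<in>J. U j \<omega> \<le> a j} \<omega>" .
        qed
      qed (use set \<Phi>_bound in auto)
      then show ?thesis using set by simp
    qed
    show "measure M {\<omega> \<in> space M. \<forall>j\<in>J. X j \<omega> \<le> a j} = measure M {\<omega> \<in> space M. \<forall>j\<in>J. X' j \<omega> \<le> a j}"
    proof (rule LIMSEQ_unique)
      show "(\<lambda>k. \<integral>\<omega>. \<Phi> J a k (\<lambda>t. X t \<omega>) \<partial>M) \<longlonglongrightarrow> measure M {\<omega> \<in> space M. \<forall>j\<in>J. X j \<omega> \<le> a j}"
        by (rule lim[OF X])
      show "(\<lambda>k. \<integral>\<omega>. \<Phi> J a k (\<lambda>t. X t \<omega>) \<partial>M) \<longlonglongrightarrow> measure M {\<omega> \<in> space M. \<forall>j\<in>J. X' j \<omega> \<le> a j}"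
        unfolding eq[OF J(2)] by (rule lim[OF X'])
    qed
  qed (use X X' in auto)
qed

section \<open>The space of paths\<close>

text \<open>
  The set of regular paths is not measurable in the product space; the trace \<open>\<sigma>\<close>-algebra
  still carries the functionals of the paths and the equality of the shifted laws.
\<close>

definition path_space :: "(real \<Rightarrow> real \<times> real) measure" where
  "path_space = restrict_space (\<Pi>\<^sub>M t\<in>(UNIV :: real set). borel)
     {p. flow_path (\<lambda>t. snd (p t)) (\<lambda>t. fst (p t))}"

lemma space_path_space: "space path_space = {p. flow_path (\<lambda>t. snd (p t)) (\<lambda>t. fst (p t))}"
  by (auto simp: path_space_def space_restrict_space space_PiM)

lemma path_space_coordinates [measurable]:
  "(\<lambda>p. fst (p t)) \<in> borel_measurable path_space" "(\<lambda>p. snd (p t)) \<in> borel_measurable path_space"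
proof -
  have coord: "(\<lambda>p. p t) \<in> measurable path_space (borel :: (real \<times> real) measure)"
    unfolding path_space_def by (intro measurable_restrict_space1 measurable_component_singleton) simp
  show "(\<lambda>p. fst (p t)) \<in> borel_measurable path_space" "(\<lambda>p. snd (p t)) \<in> borel_measurable path_space"
    by (rule measurable_compose[OF coord], intro borel_measurable_continuous_onI continuous_intros)+
qed

lemma damp_path_measurable [measurable]:
  assumes "a \<le> b"
  shows "(\<lambda>p. damp (\<lambda>t. snd (p t)) a b) \<in> borel_measurable path_space"
proof (rule borel_measurable_LIMSEQ_real)
  fix p assume "p \<in> space path_space"
  then interpret flow_path "\<lambda>t. snd (p t)" "\<lambda>t. fst (p t)" by (simp add: space_path_space)
  show "(\<lambda>n. \<Prod>i\<le>n. max 0 (1 - (snd (p (grid a b n (Suc i))) - snd (p (grid a b n i)))))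
      \<longlonglongrightarrow> damp (\<lambda>t. snd (p t)) a b"
    by (rule damp_prod_limit[OF assms])
qed measurable

lemma inflow_path_measurable [measurable]:
  assumes "a \<le> b"
  shows "(\<lambda>p. inflow (\<lambda>t. fst (p t)) (\<lambda>t. snd (p t)) a b) \<in> borel_measurable path_space"
proof (rule borel_measurable_LIMSEQ_real)
  fix p assume "p \<in> space path_space"
  then interpret flow_path "\<lambda>t. snd (p t)" "\<lambda>t. fst (p t)" by (simp add: space_path_space)
  show "(\<lambda>n. \<Sum>i\<le>n. damp (\<lambda>t. snd (p t)) (grid a b n (Suc i)) b *
        (fst (p (grid a b n (Suc i))) - fst (p (grid a b n i))))
      \<longlonglongrightarrow> inflow (\<lambda>t. fst (p t)) (\<lambda>t. snd (p t)) a b"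
    by (rule inflow_sum_limit[OF assms])
next
  show "(\<lambda>p. \<Sum>i\<le>n. damp (\<lambda>t. snd (p t)) (grid a b n (Suc i)) b *
        (fst (p (grid a b n (Suc i))) - fst (p (grid a b n i)))) \<in> borel_measurable path_space" for n
    by (intro borel_measurable_sum borel_measurable_times damp_path_measurable borel_measurable_diff
        path_space_coordinates grid_bounds[OF assms]) simp
qed

lemma xstar_path_measurable [measurable]:
  "(\<lambda>p. xstar (\<lambda>t. fst (p t)) (\<lambda>t. snd (p t)) t) \<in> borel_measurable path_space"
proof -
  have "(\<lambda>p. enn2real (SUP n. ennreal (inflow (\<lambda>t. fst (p t)) (\<lambda>t. snd (p t)) (t - real n) t)))
      \<in> borel_measurable path_space"
    by measurable
  also have "?this \<longleftrightarrow> ?thesis"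
    by (rule measurable_cong) (simp add: space_path_space flow_path.xstar_SUP)
  finally show ?thesis .
qed

section \<open>The processes\<close>

lemma (in prob_space) prob_tendsto:
  assumes "\<And>n. {\<omega> \<in> space M. P n \<omega>} \<in> events" "{\<omega> \<in> space M. Q \<omega>} \<in> events"
    and "AE \<omega> in M. \<forall>\<^sub>F n in sequentially. P n \<omega> \<longleftrightarrow> Q \<omega>"
  shows "(\<lambda>n. prob {\<omega> \<in> space M. P n \<omega>}) \<longlonglongrightarrow> prob {\<omega> \<in> space M. Q \<omega>}"
proof -
  have "(\<lambda>n. \<integral>\<omega>. indicator {\<omega> \<in> space M. P n \<omega>} \<omega> \<partial>M) \<longlonglongrightarrow> (\<integral>\<omega>. indicator {\<omega> \<in> space M. Q \<omega>} \<omega> \<partial>M :: real)"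
  proof (rule integral_dominated_convergence[where w = "\<lambda>_. 1"])
    show "AE \<omega> in M. (\<lambda>n. indicator {\<omega> \<in> space M. P n \<omega>} \<omega> :: real) \<longlonglongrightarrow> indicator {\<omega> \<in> space M. Q \<omega>} \<omega>"
      using assms(3)
    proof eventually_elim
      fix \<omega> assume "\<forall>\<^sub>F n in sequentially. P n \<omega> \<longleftrightarrow> Q \<omega>"
      then show "(\<lambda>n. indicator {\<omega> \<in> space M. P n \<omega>} \<omega> :: real) \<longlonglongrightarrow> indicator {\<omega> \<in> space M. Q \<omega>} \<omega>"
        by (intro tendsto_eventually) (auto elim!: eventually_mono simp: indicator_def)
    qed
  qed (use assms in \<open>auto simp: indicator_def\<close>)
  then show ?thesis using assms by simp
qed

locale driving_process = prob_space M for M :: "'a measure" +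
  fixes Y Z :: "real \<Rightarrow> 'a \<Rightarrow> real"
  assumes Y_measurable [measurable]: "\<And>t. Y t \<in> borel_measurable M"
    and Z_measurable [measurable]: "\<And>t. Z t \<in> borel_measurable M"
    and path: "\<And>\<omega>. \<omega> \<in> space M \<Longrightarrow> flow_path (\<lambda>t. Z t \<omega>) (\<lambda>t. Y t \<omega>)"
    and Y_0: "\<And>\<omega>. \<omega> \<in> space M \<Longrightarrow> Y 0 \<omega> = 0"
    and Z_0: "\<And>\<omega>. \<omega> \<in> space M \<Longrightarrow> Z 0 \<omega> = 0"
    and stationary: "jointly_stationary_increments M Y Z"
begin

definition shifted :: "real \<Rightarrow> 'a \<Rightarrow> real \<Rightarrow> real \<times> real" where
  "shifted s \<omega> t = (Y (t + s) \<omega> - Y s \<omega>, Z (t + s) \<omega> - Z s \<omega>)"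

lemma shifted_measurable_PiM: "shifted s \<in> measurable M (\<Pi>\<^sub>M t\<in>UNIV. borel)"
  unfolding shifted_def[abs_def]
  by (rule measurable_PiM_single') (auto intro!: borel_measurable_Pair simp: space_PiM)

lemma shifted_measurable [measurable]: "shifted s \<in> measurable M path_space"
  unfolding path_space_def
proof (rule measurable_restrict_space2[OF _ shifted_measurable_PiM])
  show "shifted s \<in> space M \<rightarrow> {p. flow_path (\<lambda>t. snd (p t)) (\<lambda>t. fst (p t))}"
    using flow_path.flow_path_shift[OF path] by (auto simp: shifted_def)
qed

text \<open>A trace set is a product-measurable set \<open>B\<close> cut with the regular paths. All
  shifted paths are regular, so the set and \<open>B\<close> have the same preimage, and equality of
  the product laws can be applied to \<open>B\<close>.\<close>

lemma shifted_law: "distr M path_space (shifted s) = distr M path_space (shifted s')"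
proof (rule measure_eqI)
  let ?P = "\<Pi>\<^sub>M t\<in>(UNIV :: real set). (borel :: (real \<times> real) measure)"
  have law: "distr M ?P (shifted s) = distr M ?P (shifted s')"
    using stationary unfolding jointly_stationary_increments_def Let_def shifted_def[abs_def] by blast
  fix A assume "A \<in> sets (distr M path_space (shifted s))"
  then obtain B where B: "B \<in> sets ?P" "A = {p. flow_path (\<lambda>t. snd (p t)) (\<lambda>t. fst (p t))} \<inter> B"
    by (auto simp: path_space_def sets_restrict_space)
  have A: "A \<in> sets path_space"
    using \<open>A \<in> _\<close> by simp
  have "emeasure (distr M path_space (shifted r)) A = emeasure (distr M ?P (shifted r)) B" for r
  proof -
    have "shifted r -` A \<inter> space M = shifted r -` B \<inter> space M"
      using measurable_space[OF shifted_measurable] unfolding B(2) by (auto simp: space_path_space)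
    then show ?thesis
      using A B(1) by (simp add: emeasure_distr shifted_measurable_PiM)
  qed
  then show "emeasure (distr M path_space (shifted s)) A = emeasure (distr M path_space (shifted s')) A"
    by (simp add: law)
qed simp

lemma functional_law:
  assumes "f \<in> measurable path_space L"
  shows "distr M L (\<lambda>\<omega>. f (shifted s \<omega>)) = distr M L (\<lambda>\<omega>. f (shifted s' \<omega>))"
  using shifted_law[of s s'] distr_distr[OF assms shifted_measurable] by (simp add: o_def) metis

section \<open>Damping and inflow as random variables\<close>

abbreviation D :: "real \<Rightarrow> real \<Rightarrow> 'a \<Rightarrow> real" where
  "D a b \<omega> \<equiv> damp (\<lambda>t. Z t \<omega>) a b"

abbreviation V :: "real \<Rightarrow> real \<Rightarrow> 'a \<Rightarrow> real" where
  "V a b \<omega> \<equiv> inflow (\<lambda>t. Y t \<omega>) (\<lambda>t. Z t \<omega>) a b"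

lemma D_shifted: "\<omega> \<in> space M \<Longrightarrow> a \<le> b \<Longrightarrow> damp (\<lambda>t. snd (shifted s \<omega> t)) a b = D (a + s) (b + s) \<omega>"
  using path[THEN flow_path.axioms(1), THEN damping_path.damp_shift] by (simp add: shifted_def)

lemma V_shifted:
  "\<omega> \<in> space M \<Longrightarrow> a \<le> b \<Longrightarrow>
    inflow (\<lambda>t. fst (shifted s \<omega> t)) (\<lambda>t. snd (shifted s \<omega> t)) a b = V (a + s) (b + s) \<omega>"
  using path[THEN flow_path.inflow_shift] by (simp add: shifted_def)

lemma X_star_shifted:
  "\<omega> \<in> space M \<Longrightarrow>
    xstar (\<lambda>t. fst (shifted s \<omega> t)) (\<lambda>t. snd (shifted s \<omega> t)) t = X_star Y Z (t + s) \<omega>"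
  using path[THEN flow_path.xstar_shift] by (simp add: shifted_def X_star_eq)

lemma D_measurable: "a \<le> b \<Longrightarrow> D a b \<in> borel_measurable M"
  using measurable_compose[OF shifted_measurable damp_path_measurable, of a b 0]
  by (subst measurable_cong[of M _ "\<lambda>\<omega>. damp (\<lambda>t. snd (shifted 0 \<omega> t)) a b"]) (simp_all add: D_shifted)

lemma V_measurable: "a \<le> b \<Longrightarrow> V a b \<in> borel_measurable M"
  using measurable_compose[OF shifted_measurable inflow_path_measurable, of a b 0]
  by (subst measurable_cong[of M _ "\<lambda>\<omega>. inflow (\<lambda>t. fst (shifted 0 \<omega> t)) (\<lambda>t. snd (shifted 0 \<omega> t)) a b"])
    (simp_all add: V_shifted)

lemma X_star_measurable: "X_star Y Z t \<in> borel_measurable M"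
  using measurable_compose[OF shifted_measurable xstar_path_measurable, of 0 t]
  by (subst measurable_cong[of M _ "\<lambda>\<omega>. xstar (\<lambda>t. fst (shifted 0 \<omega> t)) (\<lambda>t. snd (shifted 0 \<omega> t)) t"])
    (simp_all add: X_star_shifted)

text \<open>The process from time \<open>s\<close> on is one fixed measurable functional of the path
  shifted by \<open>s\<close>.\<close>

lemma X_star_stationary: "stationary_nonneg M (X_star Y Z)"
  unfolding stationary_nonneg_def
proof (intro allI impI)
  fix s :: real assume "0 \<le> s"
  let ?f = "\<lambda>p. \<lambda>t\<in>{0..}. xstar (\<lambda>t. fst (p t)) (\<lambda>t. snd (p t)) t"
  have law: "law_nonneg M (\<lambda>t. X_star Y Z (t + r)) = distr M (\<Pi>\<^sub>M t\<in>{0..}. borel) (\<lambda>\<omega>. ?f (shifted r \<omega>))" for r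
    unfolding law_nonneg_def by (rule distr_cong) (auto simp: X_star_shifted)
  have "?f \<in> measurable path_space (\<Pi>\<^sub>M t\<in>{0..}. borel)"
    by (intro measurable_restrict xstar_path_measurable)
  from functional_law[OF this] show "law_nonneg M (\<lambda>t. X_star Y Z (t + s)) = law_nonneg M (X_star Y Z)"
    using law[of s] law[of 0] by simp
qed

text \<open>The functional \<open>inflow\<close> over \<open>(-t,0]\<close> yields
  \<open>V 0 t\<close> on the path shifted by \<open>t\<close> and \<open>V (- t) 0\<close> on the
  path shifted by \<open>0\<close>.\<close>

lemma V_law:
  assumes "0 \<le> t"
  shows "distr M borel (V 0 t) = distr M borel (V (- t) 0)"
proof -
  have "distr M borel (V (- t + s) (0 + s)) =
      distr M borel (\<lambda>\<omega>. inflow (\<lambda>u. fst (shifted s \<omega> u)) (\<lambda>u. snd (shifted s \<omega> u)) (- t) 0)" for s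
    by (rule distr_cong) (simp_all add: V_shifted assms)
  from this[of t] this[of 0] functional_law[OF inflow_path_measurable[of "- t" 0], of t 0] assms
  show ?thesis by simp
qed

lemma V_prob:
  assumes "0 \<le> t" "A \<in> sets borel"
  shows "prob {\<omega> \<in> space M. V 0 t \<omega> \<in> A} = prob {\<omega> \<in> space M. V (- t) 0 \<omega> \<in> A}"
proof -
  have "measure (distr M borel (V a b)) A = prob {\<omega> \<in> space M. V a b \<omega> \<in> A}" if "a \<le> b" for a b
    using V_measurable[OF that] assms(2) by (simp add: measure_distr vimage_def Int_def conj_commute)
  from this[of 0 t] this[of "- t" 0] V_law[OF assms(1)] assms(1) show ?thesis by simp
qed

lemma solves_start:
  assumes [measurable]: "X0 \<in> borel_measurable M"
  shows "solves M Y Z X0 (\<lambda>t \<omega>. D 0 t \<omega> * X0 \<omega> + V 0 t \<omega>)"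
  unfolding solves_def
proof (intro conjI allI impI AE_I2)
  fix t :: real assume "0 \<le> t"
  note [measurable] = D_measurable[OF this] V_measurable[OF this]
  show "(\<lambda>\<omega>. D 0 t \<omega> * X0 \<omega> + V 0 t \<omega>) \<in> borel_measurable M" by measurable
next
  fix \<omega> assume \<omega>: "\<omega> \<in> space M"
  interpret flow_path "\<lambda>t. Z t \<omega>" "\<lambda>t. Y t \<omega>" by (rule path[OF \<omega>])
  show "cadlag_nonneg (\<lambda>t. D 0 t \<omega> * X0 \<omega> + V 0 t \<omega>)"
    by (rule flow_cadlag[OF is_flow_start])
  fix t :: real assume "0 \<le> t"
  from flow_solves[OF is_flow_start this, of "X0 \<omega>"]
  show "D 0 t \<omega> * X0 \<omega> + V 0 t \<omega> = X0 \<omega> + Y t \<omega> -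
      (LINT s:{0<..t}|interval_measure (\<lambda>s. Z s \<omega>). Lim (at_left s) (\<lambda>u. D 0 u \<omega> * X0 \<omega> + V 0 u \<omega>))"
    by (simp add: Y_0[OF \<omega>])
qed

lemma solves_unique:
  assumes "solves M Y Z X0 X"
  shows "AE \<omega> in M. \<forall>t\<ge>0. X t \<omega> = D 0 t \<omega> * X0 \<omega> + V 0 t \<omega>"
  using assms[unfolded solves_def, THEN conjunct2] AE_space
proof eventually_elim
  fix \<omega>
  assume X: "cadlag_nonneg (\<lambda>t. X t \<omega>) \<and> (\<forall>t\<ge>0. X t \<omega> = X0 \<omega> + Y t \<omega> -
      (LINT s:{0<..t}|interval_measure (\<lambda>s. Z s \<omega>). Lim (at_left s) (\<lambda>u. X u \<omega>)))"
    and \<omega>: "\<omega> \<in> space M"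
  interpret flow_path "\<lambda>t. Z t \<omega>" "\<lambda>t. Y t \<omega>" by (rule path[OF \<omega>])
  show "\<forall>t\<ge>0. X t \<omega> = D 0 t \<omega> * X0 \<omega> + V 0 t \<omega>"
  proof (intro allI impI)
    fix t :: real assume "0 \<le> t"
    show "X t \<omega> = D 0 t \<omega> * X0 \<omega> + V 0 t \<omega>"
    proof (rule solution_unique[OF stieltjes _ flow_cadlag[OF is_flow_start] _ _ \<open>0 \<le> t\<close>, where k = "\<lambda>t. X0 \<omega> + Y t \<omega>"])
      fix t :: real assume "0 \<le> t"
      from flow_solves[OF is_flow_start this, of "X0 \<omega>"]
      show "D 0 t \<omega> * X0 \<omega> + V 0 t \<omega> = X0 \<omega> + Y t \<omega> -
          (LINT s:{0<..t}|interval_measure (\<lambda>s. Z s \<omega>). Lim (at_left s) (\<lambda>u. D 0 u \<omega> * X0 \<omega> + V 0 u \<omega>))"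
        by (simp add: Y_0[OF \<omega>])
    qed (use X in auto)
  qed
qed

text \<open>Passing from \<open>V 0 t\<close> to \<open>V (- t) 0\<close>, which has the same law
  and is nondecreasing in \<open>t\<close> on each path, turns the comparison of probabilities into
  an inclusion of events.\<close>

lemma stochastically_increasing_start_0:
  assumes X: "solves M Y Z X0 X" and X0: "AE \<omega> in M. X0 \<omega> = 0"
  shows "stochastically_increasing M X"
  unfolding stochastically_increasing_def
proof (intro allI mono_onI)
  fix a r s :: real assume rs: "r \<in> {0..}" "s \<in> {0..}" "r \<le> s"
  have eq: "prob {\<omega> \<in> space M. X t \<omega> > a} = prob {\<omega> \<in> space M. V (- t) 0 \<omega> > a}" if "0 \<le> t" for t
  proof -
    have "X t \<in> borel_measurable M" using X that by (simp add: solves_def)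
    note [measurable] = this V_measurable[OF that]
    have "prob {\<omega> \<in> space M. X t \<omega> > a} = prob {\<omega> \<in> space M. V 0 t \<omega> > a}"
    proof (rule measure_eq_AE)
      show "AE \<omega> in M. \<omega> \<in> {\<omega> \<in> space M. X t \<omega> > a} \<longleftrightarrow> \<omega> \<in> {\<omega> \<in> space M. V 0 t \<omega> > a}"
        using solves_unique[OF X] X0 by eventually_elim (use that in auto)
    qed measurable
    also have "\<dots> = prob {\<omega> \<in> space M. V (- t) 0 \<omega> > a}"
      using V_prob[OF that, of "{a<..}"] by simp
    finally show ?thesis .
  qed
  have [measurable]: "V (- s) 0 \<in> borel_measurable M" using rs by (intro V_measurable) auto
  have "prob {\<omega> \<in> space M. V (- r) 0 \<omega> > a} \<le> prob {\<omega> \<in> space M. V (- s) 0 \<omega> > a}"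
  proof (rule finite_measure_mono)
    show "{\<omega> \<in> space M. V (- r) 0 \<omega> > a} \<subseteq> {\<omega> \<in> space M. V (- s) 0 \<omega> > a}"
    proof safe
      fix \<omega> assume \<omega>: "\<omega> \<in> space M" and "a < V (- r) 0 \<omega>"
      moreover have "V (- r) 0 \<omega> \<le> V (- s) 0 \<omega>"
        using rs by (intro flow_path.inflow_antimono[OF path[OF \<omega>]]) auto
      ultimately show "a < V (- s) 0 \<omega>" by simp
    qed
  qed measurable
  then show "prob {\<omega> \<in> space M. X r \<omega> > a} \<le> prob {\<omega> \<in> space M. X s \<omega> > a}"
    using eq[of r] eq[of s] rs by simp
qed

end

section \<open>Consequences of vanishing damping\<close>

locale ergodic_driving_process = driving_process +
  assumes past: "AE \<omega> in M. flow_path.finite_past (\<lambda>t. Z t \<omega>) (\<lambda>t. Y t \<omega>)"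
    and damping: "AE \<omega> in M. ((\<lambda>t. D 0 t \<omega>) \<longlongrightarrow> 0) at_top"
begin

lemma X_star_version: "stationary_version M Y Z (X_star Y Z)"
  unfolding stationary_version_def solves_def
proof (intro conjI allI impI X_star_stationary X_star_measurable)
  show "AE \<omega> in M. cadlag_nonneg (\<lambda>t. X_star Y Z t \<omega>) \<and>
      (\<forall>t\<ge>0. X_star Y Z t \<omega> = X_star Y Z 0 \<omega> + Y t \<omega> -
         (LINT s:{0<..t}|interval_measure (\<lambda>s. Z s \<omega>). Lim (at_left s) (\<lambda>u. X_star Y Z u \<omega>)))"
    using past AE_space
  proof eventually_elim
    fix \<omega> assume fin: "flow_path.finite_past (\<lambda>t. Z t \<omega>) (\<lambda>t. Y t \<omega>)" and \<omega>: "\<omega> \<in> space M"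
    interpret flow_path "\<lambda>t. Z t \<omega>" "\<lambda>t. Y t \<omega>" by (rule path[OF \<omega>])
    show "cadlag_nonneg (\<lambda>t. X_star Y Z t \<omega>) \<and>
      (\<forall>t\<ge>0. X_star Y Z t \<omega> = X_star Y Z 0 \<omega> + Y t \<omega> -
         (LINT s:{0<..t}|interval_measure (\<lambda>s. Z s \<omega>). Lim (at_left s) (\<lambda>u. X_star Y Z u \<omega>)))"
      unfolding X_star_eq
    proof (intro conjI allI impI flow_cadlag[OF xstar_flow[OF fin]])
      fix t :: real assume "0 \<le> t"
      from flow_solves[OF xstar_flow[OF fin] this]
      show "xstar (\<lambda>s. Y s \<omega>) (\<lambda>s. Z s \<omega>) t = xstar (\<lambda>s. Y s \<omega>) (\<lambda>s. Z s \<omega>) 0 + Y t \<omega> -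
          (LINT s:{0<..t}|interval_measure (\<lambda>s. Z s \<omega>). Lim (at_left s) (xstar (\<lambda>s. Y s \<omega>) (\<lambda>s. Z s \<omega>)))"
        by (simp only: Y_0[OF \<omega>] diff_zero)
    qed
  qed
qed

text \<open>The initial value \<open>X 0\<close> may depend on the whole driving path, future
  included. The difference to \<open>X_star\<close> is \<open>D 0 t\<close> times a fixed random
  variable, so the two processes merge pathwise, which determines the law.\<close>

lemma stationary_version_unique:
  assumes "stationary_version M Y Z X"
  shows "law_nonneg M X = law_nonneg M (X_star Y Z)"
proof (rule stationary_law_eq[OF prob_space_axioms])
  have X: "solves M Y Z (X 0) X" and star: "solves M Y Z (X_star Y Z 0) (X_star Y Z)"
    using assms X_star_version by (auto simp: stationary_version_def)
  show "stationary_nonneg M X" using assms by (simp add: stationary_version_def)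
  show "X t \<in> borel_measurable M" if "0 \<le> t" for t using X that by (simp add: solves_def)
  show "AE \<omega> in M. \<forall>t\<ge>0. (\<lambda>n. X (t + real n) \<omega> - X_star Y Z (t + real n) \<omega>) \<longlonglongrightarrow> 0"
    using solves_unique[OF X] solves_unique[OF star] damping
  proof eventually_elim
    fix \<omega>
    assume eq: "\<forall>t\<ge>0. X t \<omega> = D 0 t \<omega> * X 0 \<omega> + V 0 t \<omega>"
      "\<forall>t\<ge>0. X_star Y Z t \<omega> = D 0 t \<omega> * X_star Y Z 0 \<omega> + V 0 t \<omega>"
      and lim: "((\<lambda>t. D 0 t \<omega>) \<longlongrightarrow> 0) at_top"
    show "\<forall>t\<ge>0. (\<lambda>n. X (t + real n) \<omega> - X_star Y Z (t + real n) \<omega>) \<longlonglongrightarrow> 0"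
    proof (intro allI impI)
      fix t :: real assume "0 \<le> t"
      have "filterlim (\<lambda>n. t + real n) at_top sequentially"
        by (rule filterlim_tendsto_add_at_top[OF tendsto_const filterlim_real_sequentially])
      from tendsto_mult_left_zero[OF filterlim_compose[OF lim this]]
      have "(\<lambda>n. D 0 (t + real n) \<omega> * (X 0 \<omega> - X_star Y Z 0 \<omega>)) \<longlonglongrightarrow> 0" .
      moreover have "D 0 (t + real n) \<omega> * (X 0 \<omega> - X_star Y Z 0 \<omega>) =
          X (t + real n) \<omega> - X_star Y Z (t + real n) \<omega>" for n
      proof -
        have "0 \<le> t + real n" using \<open>0 \<le> t\<close> by simp
        then show ?thesis
          using eq(1)[rule_format, of "t + real n"] eq(2)[rule_format, of "t + real n"]
          by (simp only: right_diff_distrib)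
      qed
      ultimately show "(\<lambda>n. X (t + real n) \<omega> - X_star Y Z (t + real n) \<omega>) \<longlonglongrightarrow> 0" by simp
    qed
  qed
qed (simp_all add: X_star_measurable X_star_stationary)

text \<open>Up to the probability \<open>r h t\<close> that the damped initial value exceeds
  \<open>h\<close>, the distribution function of \<open>X t\<close> at \<open>x\<close> lies between
  those of \<open>V (- t) 0\<close> at \<open>x - h\<close> and \<open>x + h\<close>.\<close>

lemma converges_to_X_star:
  assumes [measurable]: "X0 \<in> borel_measurable M" and X: "solves M Y Z X0 X"
  shows "converges_in_distribution M X (X_star Y Z 0)"
  unfolding converges_in_distribution_def
proof (intro allI impI)
  fix x
  let ?L = "X_star Y Z 0"
  assume cont: "isCont (cdf (distr M borel ?L)) x"
  have cdf_eq: "cdf (distr M borel U) c = prob {\<omega> \<in> space M. U \<omega> \<le> c}" if "U \<in> borel_measurable M" for U c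
    using that by (simp add: cdf_def measure_distr vimage_def Int_def conj_commute)
  note [measurable] = X_star_measurable
  have star: "AE \<omega> in M. (\<forall>t\<ge>0. V (- t) 0 \<omega> \<le> ?L \<omega>) \<and> (\<lambda>n. V (- real n) 0 \<omega>) \<longlonglongrightarrow> ?L \<omega>"
    using past AE_space
  proof eventually_elim
    fix \<omega> assume fin: "flow_path.finite_past (\<lambda>t. Z t \<omega>) (\<lambda>t. Y t \<omega>)" and \<omega>: "\<omega> \<in> space M"
    interpret flow_path "\<lambda>t. Z t \<omega>" "\<lambda>t. Y t \<omega>" by (rule path[OF \<omega>])
    show "(\<forall>t\<ge>0. V (- t) 0 \<omega> \<le> ?L \<omega>) \<and> (\<lambda>n. V (- real n) 0 \<omega>) \<longlonglongrightarrow> ?L \<omega>"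
      using inflow_le_xstar[OF fin] inflow_tendsto_xstar[OF fin] by (simp add: X_star_eq)
  qed
  define r where "r h t = prob {\<omega> \<in> space M. h < \<bar>D 0 t \<omega> * X0 \<omega>\<bar>}" for h t
  define v where "v c t = prob {\<omega> \<in> space M. V (- t) 0 \<omega> \<le> c}" for c t
  define f where "f c = prob {\<omega> \<in> space M. ?L \<omega> \<le> c}" for c
  have r_lim: "(\<lambda>n. r h (real n)) \<longlonglongrightarrow> 0" if "0 < h" for h
  proof -
    note [measurable] = D_measurable[of 0 "real n" for n, OF of_nat_0_le_iff]
    have "(\<lambda>n. r h (real n)) \<longlonglongrightarrow> prob {\<omega> \<in> space M. False}"
      unfolding r_def
    proof (rule prob_tendsto)
      show "AE \<omega> in M. \<forall>\<^sub>F n in sequentially. h < \<bar>D 0 (real n) \<omega> * X0 \<omega>\<bar> \<longleftrightarrow> False"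
        using damping
      proof eventually_elim
        fix \<omega> assume "((\<lambda>t. D 0 t \<omega>) \<longlongrightarrow> 0) at_top"
        from tendsto_mult_left_zero[OF filterlim_compose[OF this filterlim_real_sequentially]]
        have "(\<lambda>n. \<bar>D 0 (real n) \<omega> * X0 \<omega>\<bar>) \<longlonglongrightarrow> 0" by (rule tendsto_rabs_zero)
        from order_tendstoD(2)[OF this \<open>0 < h\<close>]
        show "\<forall>\<^sub>F n in sequentially. h < \<bar>D 0 (real n) \<omega> * X0 \<omega>\<bar> \<longleftrightarrow> False"
          by eventually_elim simp
      qed
    qed measurable
    then show ?thesis by simp
  qed
  have r_mono: "r h t \<le> r h s" if "0 \<le> s" "s \<le> t" for h s t
    unfolding r_def
  proof (rule finite_measure_mono)
    note [measurable] = D_measurable[OF \<open>0 \<le> s\<close>]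
    show "{\<omega> \<in> space M. h < \<bar>D 0 s \<omega> * X0 \<omega>\<bar>} \<in> events" by measurable
    show "{\<omega> \<in> space M. h < \<bar>D 0 t \<omega> * X0 \<omega>\<bar>} \<subseteq> {\<omega> \<in> space M. h < \<bar>D 0 s \<omega> * X0 \<omega>\<bar>}"
    proof safe
      fix \<omega> assume \<omega>: "\<omega> \<in> space M" and "h < \<bar>D 0 t \<omega> * X0 \<omega>\<bar>"
      interpret flow_path "\<lambda>t. Z t \<omega>" "\<lambda>t. Y t \<omega>" by (rule path[OF \<omega>])
      have "\<bar>D 0 t \<omega> * X0 \<omega>\<bar> \<le> \<bar>D 0 s \<omega> * X0 \<omega>\<bar>"
        using damp_antimono_right[OF that] by (auto simp: abs_mult damp_nonneg intro: mult_right_mono)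
      then show "h < \<bar>D 0 s \<omega> * X0 \<omega>\<bar>" using \<open>h < _\<close> by simp
    qed
  qed
  have v_lim: "(\<lambda>n. v c (real n)) \<longlonglongrightarrow> f c" for c
    unfolding v_def f_def
  proof (rule prob_tendsto)
    have [measurable]: "V (- real n) 0 \<in> borel_measurable M" for n by (rule V_measurable) simp
    show "{\<omega> \<in> space M. V (- real n) 0 \<omega> \<le> c} \<in> events" for n by measurable
    show "AE \<omega> in M. \<forall>\<^sub>F n in sequentially. V (- real n) 0 \<omega> \<le> c \<longleftrightarrow> ?L \<omega> \<le> c"
      using star
    proof eventually_elim
      fix \<omega> assume lim: "(\<forall>t\<ge>0. V (- t) 0 \<omega> \<le> ?L \<omega>) \<and> (\<lambda>n. V (- real n) 0 \<omega>) \<longlonglongrightarrow> ?L \<omega>"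
      show "\<forall>\<^sub>F n in sequentially. V (- real n) 0 \<omega> \<le> c \<longleftrightarrow> ?L \<omega> \<le> c"
      proof (cases "?L \<omega> \<le> c")
        \<comment> \<open>\<open>V\<close> approaches the limit from below, so the event with
          \<open>\<le> c\<close> is stable even when the limit equals \<open>c\<close>; convergence
          holds at every \<open>c\<close>, atoms included.\<close>
        case True
        then have "V (- real n) 0 \<omega> \<le> c" for n
          using lim order_trans[of "V (- real n) 0 \<omega>" "?L \<omega>" c] by simp
        then show ?thesis using True by simp
      next
        case False
        then have "\<forall>\<^sub>F n in sequentially. c < V (- real n) 0 \<omega>"
          using lim by (intro order_tendstoD(1)[where y = "?L \<omega>"]) auto
        then show ?thesis by eventually_elim (use False in simp)
      qed
    qed
  qed measurable
  have v_mono: "v c t \<le> v c s" if "0 \<le> s" "s \<le> t" for c s t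
    unfolding v_def
  proof (rule finite_measure_mono)
    have [measurable]: "V (- s) 0 \<in> borel_measurable M" by (rule V_measurable) (use that in simp)
    show "{\<omega> \<in> space M. V (- s) 0 \<omega> \<le> c} \<in> events" by measurable
    show "{\<omega> \<in> space M. V (- t) 0 \<omega> \<le> c} \<subseteq> {\<omega> \<in> space M. V (- s) 0 \<omega> \<le> c}"
    proof safe
      fix \<omega> assume \<omega>: "\<omega> \<in> space M" and "V (- t) 0 \<omega> \<le> c"
      moreover have "V (- s) 0 \<omega> \<le> V (- t) 0 \<omega>"
        using that by (intro flow_path.inflow_antimono[OF path[OF \<omega>]]) auto
      ultimately show "V (- s) 0 \<omega> \<le> c" by simp
    qed
  qed
  have v_ge: "f c \<le> v c t" if "0 \<le> t" for c t
    unfolding f_def v_def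
  proof (rule finite_measure_mono_AE)
    have [measurable]: "V (- t) 0 \<in> borel_measurable M" by (rule V_measurable) (use that in simp)
    show "{\<omega> \<in> space M. V (- t) 0 \<omega> \<le> c} \<in> events" by measurable
    show "AE \<omega> in M. \<omega> \<in> {\<omega> \<in> space M. ?L \<omega> \<le> c} \<longrightarrow> \<omega> \<in> {\<omega> \<in> space M. V (- t) 0 \<omega> \<le> c}"
      using star by eventually_elim (use that in \<open>auto intro: order_trans\<close>)
  qed
  have v_eq: "v c t = prob {\<omega> \<in> space M. V 0 t \<omega> \<le> c}" if "0 \<le> t" for c t
    using V_prob[OF that, of "{..c}"] by (simp add: v_def)
  have bounds: "v (x - h) t - r h t \<le> prob {\<omega> \<in> space M. X t \<omega> \<le> x}"
    "prob {\<omega> \<in> space M. X t \<omega> \<le> x} \<le> v (x + h) t + r h t" if "0 \<le> t" for h t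
  proof -
    have "X t \<in> borel_measurable M" using X that by (simp add: solves_def)
    note [measurable] = this V_measurable[OF that] D_measurable[OF that]
    let ?X = "{\<omega> \<in> space M. X t \<omega> \<le> x}" and ?r = "{\<omega> \<in> space M. h < \<bar>D 0 t \<omega> * X0 \<omega>\<bar>}"
    have sets: "?X \<in> events" "?r \<in> events" "{\<omega> \<in> space M. V 0 t \<omega> \<le> c} \<in> events" for c
      by measurable
    have "prob {\<omega> \<in> space M. V 0 t \<omega> \<le> x - h} \<le> prob (?X \<union> ?r)"
    proof (rule finite_measure_mono_AE)
      show "AE \<omega> in M. \<omega> \<in> {\<omega> \<in> space M. V 0 t \<omega> \<le> x - h} \<longrightarrow> \<omega> \<in> ?X \<union> ?r"
        using solves_unique[OF X] by eventually_elim (use that in auto)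
    qed (use sets in auto)
    also have "\<dots> \<le> prob ?X + prob ?r"
      using sets by (intro measure_Un_le)
    finally show "v (x - h) t - r h t \<le> prob ?X" by (simp add: v_eq[OF that] r_def)
    have "prob ?X \<le> prob ({\<omega> \<in> space M. V 0 t \<omega> \<le> x + h} \<union> ?r)"
    proof (rule finite_measure_mono_AE)
      show "AE \<omega> in M. \<omega> \<in> ?X \<longrightarrow> \<omega> \<in> {\<omega> \<in> space M. V 0 t \<omega> \<le> x + h} \<union> ?r"
        using solves_unique[OF X] by eventually_elim (use that in auto)
    qed (use sets in auto)
    also have "\<dots> \<le> prob {\<omega> \<in> space M. V 0 t \<omega> \<le> x + h} + prob ?r"
      using sets by (intro measure_Un_le)
    finally show "prob ?X \<le> v (x + h) t + r h t" by (simp add: v_eq[OF that] r_def)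
  qed
  have "cdf (distr M borel ?L) = f"
    by (rule ext) (simp add: cdf_eq X_star_measurable f_def)
  with cont have f_cont: "isCont f x" by simp
  have "((\<lambda>t. prob {\<omega> \<in> space M. X t \<omega> \<le> x}) \<longlongrightarrow> f x) at_top"
  proof (rule tendstoI)
    fix e :: real assume "0 < e"
    then have "0 < e / 3" by simp
    from f_cont[unfolded continuous_at_eps_delta, rule_format, OF this]
    obtain d where "0 < d" and d: "\<And>c. \<bar>c - x\<bar> < d \<Longrightarrow> \<bar>f c - f x\<bar> < e / 3"
      by (auto simp: dist_real_def)
    \<comment> \<open>Half of \<open>d\<close> keeps \<open>x + h\<close> and \<open>x - h\<close>
      strictly within the continuity radius. One third of \<open>e\<close> goes to continuity of
      \<open>f\<close>, one to \<open>r\<close>, one to \<open>v\<close> against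
      \<open>f\<close>.\<close>
    define h where "h = d / 2"
    have h: "0 < h" "\<bar>f (x + h) - f x\<bar> < e / 3" "\<bar>f (x - h) - f x\<bar> < e / 3"
      using \<open>0 < d\<close> d[of "x + h"] d[of "x - h"] by (simp_all add: h_def)
    have "\<forall>\<^sub>F n in sequentially. r h (real n) < e / 3 \<and> v (x + h) (real n) < f (x + h) + e / 3"
      using \<open>0 < e\<close> by (intro eventually_conj order_tendstoD(2)[OF r_lim[OF h(1)]] order_tendstoD(2)[OF v_lim]) auto
    then obtain n where n: "r h (real n) < e / 3" "v (x + h) (real n) < f (x + h) + e / 3"
      by (auto simp: eventually_sequentially)
    show "\<forall>\<^sub>F t in at_top. dist (prob {\<omega> \<in> space M. X t \<omega> \<le> x}) (f x) < e"
      using eventually_ge_at_top[of "real n"]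
    proof eventually_elim
      fix t assume t: "real n \<le> t"
      then have "0 \<le> t" by (rule order_trans[rotated]) simp
      show "dist (prob {\<omega> \<in> space M. X t \<omega> \<le> x}) (f x) < e"
        using bounds[OF \<open>0 \<le> t\<close>, of h] v_ge[OF \<open>0 \<le> t\<close>, of "x - h"] n h
          r_mono[OF of_nat_0_le_iff t, of h] v_mono[OF of_nat_0_le_iff t, of "x + h"]
        unfolding dist_real_def by linarith
    qed
  qed
  moreover have "\<forall>\<^sub>F t in at_top. prob {\<omega> \<in> space M. X t \<omega> \<le> x} = cdf (distr M borel (X t)) x"
    using eventually_ge_at_top[of 0]
    by eventually_elim (use X in \<open>simp add: cdf_eq solves_def\<close>)
  ultimately have "((\<lambda>t. cdf (distr M borel (X t)) x) \<longlongrightarrow> f x) at_top"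
    by (rule Lim_transform_eventually)
  then show "((\<lambda>t. cdf (distr M borel (X t)) x) \<longlongrightarrow> cdf (distr M borel ?L) x) at_top"
    by (simp add: cdf_eq X_star_measurable f_def)
qed

end

theorem theorem2:
  fixes M :: "'a measure" and Y Z :: "real \<Rightarrow> 'a \<Rightarrow> real"
  assumes "prob_space M"
    and "\<And>t. Y t \<in> borel_measurable M"
    and "\<And>t. Z t \<in> borel_measurable M"
    and "\<And>\<omega>. \<omega> \<in> space M \<Longrightarrow> mono (\<lambda>t. Y t \<omega>)"
    and "\<And>\<omega>. \<omega> \<in> space M \<Longrightarrow> mono (\<lambda>t. Z t \<omega>)"
    and "\<And>\<omega> t. \<omega> \<in> space M \<Longrightarrow> continuous (at_right t) (\<lambda>t. Y t \<omega>)"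
    and "\<And>\<omega> t. \<omega> \<in> space M \<Longrightarrow> continuous (at_right t) (\<lambda>t. Z t \<omega>)"
    and "\<And>\<omega>. \<omega> \<in> space M \<Longrightarrow> Y 0 \<omega> = 0"
    and "\<And>\<omega>. \<omega> \<in> space M \<Longrightarrow> Z 0 \<omega> = 0"
    and "jointly_stationary_increments M Y Z"
    and "\<And>\<omega> t. \<omega> \<in> space M \<Longrightarrow> jump (\<lambda>t. Z t \<omega>) t \<le> 1"
    and "AE \<omega> in M.
           (\<integral>\<^sup>+s\<in>{..0}. ennreal (exp (J_path (\<lambda>t. Z t \<omega>) s)) \<partial>interval_measure (\<lambda>t. Y t \<omega>)) < \<infinity>"
    and "(AE \<omega> in M. T1_path (\<lambda>t. Z t \<omega>) < \<infinity>) \<or>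
         (AE \<omega> in M. filterlim (J_path (\<lambda>t. Z t \<omega>)) at_top at_top)"
  shows "(\<forall>X0 \<in> borel_measurable M. \<exists>X. solves M Y Z X0 X \<and>
            (\<forall>X'. solves M Y Z X0 X' \<longrightarrow> (AE \<omega> in M. \<forall>t\<ge>0. X' t \<omega> = X t \<omega>)))
       \<and> stationary_version M Y Z (X_star Y Z)
       \<and> (\<forall>X'. stationary_version M Y Z X' \<longrightarrow> law_nonneg M X' = law_nonneg M (X_star Y Z))
       \<and> (\<forall>X0 \<in> borel_measurable M. \<forall>X. solves M Y Z X0 X \<longrightarrow>
            converges_in_distribution M X (X_star Y Z 0))
       \<and> (\<forall>X0 \<in> borel_measurable M. \<forall>X. solves M Y Z X0 X \<and> (AE \<omega> in M. X0 \<omega> = 0) \<longrightarrow>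
            stochastically_increasing M X)"
proof -
  interpret prob_space M by fact
  have path: "flow_path (\<lambda>t. Z t \<omega>) (\<lambda>t. Y t \<omega>)" if "\<omega> \<in> space M" for \<omega>
    using that assms(4-7,11) by unfold_locales (simp_all add: stieltjes_def)
  have past: "AE \<omega> in M. flow_path.finite_past (\<lambda>t. Z t \<omega>) (\<lambda>t. Y t \<omega>)"
    using assms(12) AE_space by eventually_elim (rule flow_path.finite_pastI[OF path])
  have "AE \<omega> in M. T1_path (\<lambda>t. Z t \<omega>) < \<infinity> \<or> filterlim (J_path (\<lambda>t. Z t \<omega>)) at_top at_top"
    using assms(13) by (auto elim: AE_mp)
  then have damping: "AE \<omega> in M. ((\<lambda>t. damp (\<lambda>t. Z t \<omega>) 0 t) \<longlongrightarrow> 0) at_top"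
    using AE_space
    by eventually_elim (rule damping_path.damp_tendsto_0[OF flow_path.axioms(1)[OF path]])
  interpret ergodic_driving_process M Y Z
    by (intro ergodic_driving_process.intro driving_process.intro driving_process_axioms.intro
        ergodic_driving_process_axioms.intro prob_space_axioms path past damping assms(2,3,8-10))
  have "\<exists>X. solves M Y Z X0 X \<and> (\<forall>X'. solves M Y Z X0 X' \<longrightarrow> (AE \<omega> in M. \<forall>t\<ge>0. X' t \<omega> = X t \<omega>))"
    if "X0 \<in> borel_measurable M" for X0
    using solves_start[OF that] solves_unique by blast
  then show ?thesis
    using X_star_version stationary_version_unique converges_to_X_star stochastically_increasing_start_0
    by blast
qed

end
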